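(* The outcome of the Maker-Breaker domination game on a tree (given as a starting position) can be decided in polynomial time.
   Context: The Maker-Breaker domination game on a graph: Dominator and Staller alternately choose a not-yet-chosen vertex (no passing), starting with all vertices unchosen; when all vertices are chosen, Dominator wins if his vertices form a dominating set of the graph, otherwise Staller wins. The outcome is $\mathcal D$ if Dominator has a winning strategy both as first and as second player, $\mathcal S$ if Staller has a winning strategy both as first and as second player, and $\mathcal N$ if the first player has a winning strategy; every graph has one of these three outcomes. *)

theory Defs
  imports Main
begin

section \<open>Graphs given as edge lists on vertex set {0..<n}\<close>

definition adj :: "(nat \<times> nat) list \<Rightarrow> nat \<Rightarrow> nat \<Rightarrow> bool" where
  "adj es u v \<longleftrightarrow> (u, v) \<in> set es \<or> (v, u) \<in> set es"

text \<open>A tree on vertices {0..<n}: at least one vertex, n-1 edges, all endpoints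
  valid, no loops, and connected.\<close>
definition is_tree :: "nat \<Rightarrow> (nat \<times> nat) list \<Rightarrow> bool" where
  "is_tree n es \<longleftrightarrow> n \<ge> 1 \<and> length es = n - 1
     \<and> (\<forall>(u, v) \<in> set es. u < n \<and> v < n \<and> u \<noteq> v)
     \<and> (\<forall>u < n. \<forall>v < n. (u, v) \<in> {(x, y). adj es x y}\<^sup>*)"

definition dominating :: "nat \<Rightarrow> (nat \<times> nat) list \<Rightarrow> nat set \<Rightarrow> bool" where
  "dominating n es D \<longleftrightarrow> (\<forall>v < n. v \<in> D \<or> (\<exists>u \<in> D. adj es u v))"

section \<open>The Maker-Breaker domination game\<close>

text \<open>Positions: D = vertices chosen by Dominator, S = vertices chosen by Staller;
  the boolean is True iff it is Dominator's turn. dom_wins: Dominator has a winning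
  strategy from the position; stal_wins: Staller has a winning strategy.\<close>

inductive dom_wins :: "nat \<Rightarrow> (nat \<times> nat) list \<Rightarrow> nat set \<Rightarrow> nat set \<Rightarrow> bool \<Rightarrow> bool"
  for n es where
  dw_end: "D \<union> S = {0..<n} \<Longrightarrow> dominating n es D \<Longrightarrow> dom_wins n es D S p"
| dw_dmove: "v < n \<Longrightarrow> v \<notin> D \<Longrightarrow> v \<notin> S \<Longrightarrow> dom_wins n es (insert v D) S False
     \<Longrightarrow> dom_wins n es D S True"
| dw_smove: "D \<union> S \<noteq> {0..<n} \<Longrightarrow>
     (\<forall>v. v < n \<and> v \<notin> D \<and> v \<notin> S \<longrightarrow> dom_wins n es D (insert v S) True)
     \<Longrightarrow> dom_wins n es D S False"

inductive stal_wins :: "nat \<Rightarrow> (nat \<times> nat) list \<Rightarrow> nat set \<Rightarrow> nat set \<Rightarrow> bool \<Rightarrow> bool"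
  for n es where
  sw_end: "D \<union> S = {0..<n} \<Longrightarrow> \<not> dominating n es D \<Longrightarrow> stal_wins n es D S p"
| sw_smove: "v < n \<Longrightarrow> v \<notin> D \<Longrightarrow> v \<notin> S \<Longrightarrow> stal_wins n es D (insert v S) True
     \<Longrightarrow> stal_wins n es D S False"
| sw_dmove: "D \<union> S \<noteq> {0..<n} \<Longrightarrow>
     (\<forall>v. v < n \<and> v \<notin> D \<and> v \<notin> S \<longrightarrow> stal_wins n es (insert v D) S False)
     \<Longrightarrow> stal_wins n es D S True"

datatype outcome = OutD | OutN | OutS

definition has_outcome :: "nat \<Rightarrow> (nat \<times> nat) list \<Rightarrow> outcome \<Rightarrow> bool" where
  "has_outcome n es r \<longleftrightarrow> (case r of
     OutD \<Rightarrow> dom_wins n es {} {} True \<and> dom_wins n es {} {} False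
   | OutS \<Rightarrow> stal_wins n es {} {} False \<and> stal_wins n es {} {} True
   | OutN \<Rightarrow> dom_wins n es {} {} True \<and> stal_wins n es {} {} False)"

fun outcome_code :: "outcome \<Rightarrow> nat" where
  "outcome_code OutD = 0" | "outcome_code OutN = 1" | "outcome_code OutS = 2"

section \<open>Machine model: unit-cost RAM with addition, truncated subtraction,
  indirect addressing (polynomially equivalent to Turing machines)\<close>

datatype instr =
    Const nat nat      (* Const r c : m r := c *)
  | Add nat nat nat    (* Add r a b : m r := m a + m b *)
  | Sub nat nat nat    (* Sub r a b : m r := m a - m b (truncated) *)
  | Load nat nat       (* Load r a : m r := m (m a) *)
  | Store nat nat      (* Store a r : m (m a) := m r *)
  | Jz nat nat         (* Jz r l : if m r = 0 then goto l *)
  | Jmp nat            (* Jmp l : goto l *)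

type_synonym config = "nat \<times> (nat \<Rightarrow> nat)"

text \<open>One step; a configuration whose program counter is outside the program is halted.\<close>
fun exec :: "instr list \<Rightarrow> config \<Rightarrow> config" where
  "exec P (pc, m) = (if pc < length P then (case P ! pc of
       Const r c \<Rightarrow> (pc + 1, m(r := c))
     | Add r a b \<Rightarrow> (pc + 1, m(r := m a + m b))
     | Sub r a b \<Rightarrow> (pc + 1, m(r := m a - m b))
     | Load r a \<Rightarrow> (pc + 1, m(r := m (m a)))
     | Store a r \<Rightarrow> (pc + 1, m(m a := m r))
     | Jz r l \<Rightarrow> (if m r = 0 then l else pc + 1, m)
     | Jmp l \<Rightarrow> (l, m))
   else (pc, m))"

text \<open>Input encoding: m 0 = n, m 1 = number of edges, edge i stored at 2+2i, 3+2i.\<close>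
definition init_mem :: "nat \<Rightarrow> (nat \<times> nat) list \<Rightarrow> nat \<Rightarrow> nat" where
  "init_mem n es i =
     (if i = 0 then n
      else if i = 1 then length es
      else if 2 \<le> i \<and> i < 2 + 2 * length es then
        (if even (i - 2) then fst (es ! ((i - 2) div 2)) else snd (es ! ((i - 2) div 2)))
      else 0)"

definition run :: "instr list \<Rightarrow> nat \<Rightarrow> nat \<Rightarrow> (nat \<times> nat) list \<Rightarrow> config" where
  "run P t n es = (exec P ^^ t) (0, init_mem n es)"

end

theory Submission
  imports Defs
begin

text \<open>If \<open>a\<close> is a leaf whose neighbour \<open>b\<close> has degree at most 2, deleting \<open>a\<close> and \<open>b\<close> does not change who
  wins: Dominator can pair \<open>a\<close> with \<open>b\<close>, and Staller can at his first move take \<open>b\<close>, forcing Dominator to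
  take \<open>a\<close>. After exhaustive deletion the residual tree is either empty (Dominator wins even as
  second player), or a star or single vertex (the first player wins), or it has two vertices each
  carrying two leaves; such a vertex is a double threat for Staller, and Dominator cannot defuse
  both, so Staller wins even as second player. Degrees, deletions and the star test are computed by
  nested loops over the edge list in cubic time.

  The residual graphs are controlled by counting only: in a tree every nonempty vertex set \<open>X\<close> spans
  fewer than \<open>|X|\<close> edges, and \<open>A\<close> induces a subtree iff it spans exactly \<open>|A| - 1\<close>.\<close>

text \<open>Deleting a pair is delicate when Dominator moves first: he may open with
  \<open>b\<close>, which also dominates its remaining neighbour \<open>w\<close>, so Staller cannot
  simply force the pair. Owning \<open>w\<close> in the smaller game then turns out to be at least
  as good for Dominator as owning \<open>b\<close> in the larger one. Every pendant pair may go, so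
  the order of deletions is immaterial and the machine can sweep the edge list blindly. Each sweep
  either deletes something or certifies that nothing is removable, hence \<open>n\<close> sweeps
  suffice; a sweep runs a linear degree count for each edge, which gives the cubic bound. The two
  vertices with two leaves each come from stripping all leaves off the residual tree. What remains
  is again a tree, and a vertex with at most one neighbour in it has at least two leaves, since with
  only one leaf it would form a removable pair. If the stripped tree has more than one vertex, it
  has two such ends. Counting replaces paths and components once the input condition is translated,
  and it turns the star test into a comparison of one degree with the number of surviving
  vertices.\<close>

section \<open>The game and pendant pairs\<close>

text \<open>\<open>dwin W U D p\<close>: with \<open>U\<close> unclaimed and \<open>D\<close> owned by Dominator, who moves next iff \<open>p\<close>, Dominator
  can force his final set to satisfy \<open>W\<close>.\<close>

function dwin :: "('a set \<Rightarrow> bool) \<Rightarrow> 'a set \<Rightarrow> 'a set \<Rightarrow> bool \<Rightarrow> bool" where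
  "dwin W U D p =
     (if finite U \<and> U \<noteq> {}
      then if p then \<exists>v\<in>U. dwin W (U - {v}) (insert v D) False
           else \<forall>v\<in>U. dwin W (U - {v}) D True
      else W D)"
  by auto
termination
  by (relation "measure (\<lambda>(W, U, D, p). card U)") (auto simp: card_gt_0_iff)

declare dwin.simps [simp del]

lemma dwin_empty [simp]: "dwin W {} D p \<longleftrightarrow> W D"
  by (simp add: dwin.simps)

lemma dwin_True:
  "finite U \<Longrightarrow> U \<noteq> {} \<Longrightarrow> dwin W U D True \<longleftrightarrow> (\<exists>v\<in>U. dwin W (U - {v}) (insert v D) False)"
  by (simp add: dwin.simps[of W U D True])

lemma dwin_False:
  "finite U \<Longrightarrow> U \<noteq> {} \<Longrightarrow> dwin W U D False \<longleftrightarrow> (\<forall>v\<in>U. dwin W (U - {v}) D True)"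
  by (simp add: dwin.simps[of W U D False])

lemma dwin_TrueI:
  "finite U \<Longrightarrow> v \<in> U \<Longrightarrow> dwin W (U - {v}) (insert v D) False \<Longrightarrow> dwin W U D True"
  by (subst dwin_True) auto

lemma dwin_FalseD:
  "dwin W U D False \<Longrightarrow> finite U \<Longrightarrow> v \<in> U \<Longrightarrow> dwin W (U - {v}) D True"
  by (subst (asm) dwin_False) auto

lemma dwin_TrueE:
  assumes "dwin W U D True" "finite U" "U \<noteq> {}"
  obtains v where "v \<in> U" "dwin W (U - {v}) (insert v D) False"
  using assms by (auto simp: dwin_True)

lemma dwin_FalseI:
  "finite U \<Longrightarrow> U \<noteq> {} \<Longrightarrow> (\<And>v. v \<in> U \<Longrightarrow> dwin W (U - {v}) D True) \<Longrightarrow> dwin W U D False"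
  by (simp add: dwin_False)

text \<open>Dominator copies his moves unchanged. \<open>D1\<close> and \<open>D2\<close> may
  differ, so that vertices gained or given up in an exchange outside \<open>U\<close> can be
  accounted for.\<close>

lemma dwin_mono:
  assumes "finite U"
    and "\<And>X. X \<subseteq> U \<Longrightarrow> W1 (D1 \<union> X) \<Longrightarrow> W2 (D2 \<union> X)"
    and "dwin W1 U D1 p"
  shows "dwin W2 U D2 p"
  using assms
proof (induction U arbitrary: D1 D2 p rule: finite_psubset_induct)
  case (psubset U)
  show ?case
  proof (cases "U = {}")
    case True
    then show ?thesis using psubset.prems(1)[of "{}"] psubset.prems(2) by simp
  next
    case ne: False
    show ?thesis
    proof (cases p)
      case True
      then obtain v where v: "v \<in> U" "dwin W1 (U - {v}) (insert v D1) False"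
        using psubset.prems(2) ne psubset.hyps by (auto simp: dwin_True)
      have "dwin W2 (U - {v}) (insert v D2) False"
      proof (rule psubset.IH[OF _ _ v(2)])
        show "U - {v} \<subset> U" using v by auto
        show "W2 (insert v D2 \<union> X)" if "X \<subseteq> U - {v}" "W1 (insert v D1 \<union> X)" for X
          using psubset.prems(1)[of "insert v X"] that v by auto
      qed
      then show ?thesis using True v psubset.hyps by (auto intro: dwin_TrueI)
    next
      case False
      have "dwin W2 (U - {v}) D2 True" if v: "v \<in> U" for v
      proof (rule psubset.IH)
        show "U - {v} \<subset> U" using v by auto
        show "W2 (D2 \<union> X)" if "X \<subseteq> U - {v}" "W1 (D1 \<union> X)" for X
          using psubset.prems(1)[of X] that by auto
        show "dwin W1 (U - {v}) D1 True"
          using psubset.prems(2) False v psubset.hyps by (auto dest: dwin_FalseD)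
      qed
      then show ?thesis using False ne psubset.hyps by (simp add: dwin_False)
    qed
  qed
qed

lemma dwin_surely:
  assumes "finite U" "\<And>X. X \<subseteq> U \<Longrightarrow> W (D \<union> X)"
  shows "dwin W U D p"
  using assms
proof (induction U arbitrary: D p rule: finite_psubset_induct)
  case (psubset U D p)
  show ?case
  proof (cases "U = {}")
    case True
    then show ?thesis using psubset.prems[of "{}"] by simp
  next
    case ne: False
    have 1: "dwin W (U - {v}) (insert v D) q" if v: "v \<in> U" for v q
    proof (rule psubset.IH)
      show "W (insert v D \<union> X)" if "X \<subseteq> U - {v}" for X
        using psubset.prems[of "insert v X"] that v by auto
    qed (use v in auto)
    have 2: "dwin W (U - {v}) D q" if v: "v \<in> U" for v q
      by (rule psubset.IH) (use v psubset.prems in auto)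
    have "dwin W U D True" "dwin W U D False"
      using ne 1 2 psubset.hyps by (auto simp: dwin_True dwin_False)
    then show ?thesis by (cases p) simp_all
  qed
qed

lemma not_dwin_surely:
  assumes "finite U" "\<And>X. X \<subseteq> U \<Longrightarrow> \<not> W (D \<union> X)"
  shows "\<not> dwin W U D p"
  using assms
proof (induction U arbitrary: D p rule: finite_psubset_induct)
  case (psubset U D p)
  show ?case
  proof (cases "U = {}")
    case True
    then show ?thesis using psubset.prems[of "{}"] by simp
  next
    case ne: False
    have 1: "\<not> dwin W (U - {v}) (insert v D) q" if v: "v \<in> U" for v q
    proof (rule psubset.IH)
      show "\<not> W (insert v D \<union> X)" if "X \<subseteq> U - {v}" for X
        using psubset.prems[of "insert v X"] that v by auto
    qed (use v in auto)
    have 2: "\<not> dwin W (U - {v}) D q" if v: "v \<in> U" for v q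
      by (rule psubset.IH) (use v psubset.prems in auto)
    have "\<not> dwin W U D True" "\<not> dwin W U D False"
      using ne 1 2 psubset.hyps by (auto simp: dwin_True dwin_False)
    then show ?thesis by (cases p) simp_all
  qed
qed

section \<open>Link to the two inductive winning predicates\<close>

text \<open>\<open>dwin\<close> is a boolean, so this lemma and its counterpart for
  \<open>stal_wins\<close> together give determinacy.\<close>

lemma dwin_imp_dom_wins:
  assumes "dwin (dominating n es) ({0..<n} - D - S) D p" "D \<subseteq> {0..<n}" "S \<subseteq> {0..<n}"
  shows "dom_wins n es D S p"
  using assms
proof (induction "card ({0..<n} - D - S)" arbitrary: D S p rule: less_induct)
  case less
  let ?U = "{0..<n} - D - S"
  show ?case
  proof (cases "?U = {}")
    case True
    then have "D \<union> S = {0..<n}" "dominating n es D"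
      using less.prems by (auto simp only: dwin_empty)
    then show ?thesis by (rule dw_end)
  next
    case ne: False
    have eq: "{0..<n} - insert v D - S = ?U - {v}" "{0..<n} - D - insert v S = ?U - {v}" for v
      by auto
    have dec: "card ({0..<n} - insert v D - S) < card ?U" "card ({0..<n} - D - insert v S) < card ?U"
      if "v \<in> ?U" for v
      unfolding eq by (rule card_Diff1_less[OF _ that], simp)+
    show ?thesis
    proof (cases p)
      case True
      then have "\<exists>v\<in>?U. dwin (dominating n es) (?U - {v}) (insert v D) False"
        using less.prems(1) dwin_True[of ?U "dominating n es" D] ne by simp
      then obtain v where v: "v \<in> ?U" "dwin (dominating n es) (?U - {v}) (insert v D) False" ..
      then have "dom_wins n es (insert v D) S False"
        using less.hyps[OF dec(1)[OF v(1)]] less.prems eq by auto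
      then show ?thesis using True v by (auto intro: dw_dmove)
    next
      case False
      have "dom_wins n es D (insert v S) True" if v: "v \<in> ?U" for v
        using less.hyps[OF dec(2)[OF v]] less.prems eq v False by (auto dest: dwin_FalseD)
      then show ?thesis using False ne by (auto intro!: dw_smove)
    qed
  qed
qed

lemma not_dwin_imp_stal_wins:
  assumes "\<not> dwin (dominating n es) ({0..<n} - D - S) D p" "D \<subseteq> {0..<n}" "S \<subseteq> {0..<n}"
  shows "stal_wins n es D S p"
  using assms
proof (induction "card ({0..<n} - D - S)" arbitrary: D S p rule: less_induct)
  case less
  let ?U = "{0..<n} - D - S"
  show ?case
  proof (cases "?U = {}")
    case True
    then have "D \<union> S = {0..<n}" "\<not> dominating n es D"
      using less.prems by (auto simp only: dwin_empty)
    then show ?thesis by (rule sw_end)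
  next
    case ne: False
    have eq: "{0..<n} - insert v D - S = ?U - {v}" "{0..<n} - D - insert v S = ?U - {v}" for v
      by auto
    have dec: "card ({0..<n} - insert v D - S) < card ?U" "card ({0..<n} - D - insert v S) < card ?U"
      if "v \<in> ?U" for v
      unfolding eq by (rule card_Diff1_less[OF _ that], simp)+
    show ?thesis
    proof (cases p)
      case False
      then have "\<exists>v\<in>?U. \<not> dwin (dominating n es) (?U - {v}) D True"
        using less.prems(1) dwin_False[of ?U "dominating n es" D] ne by simp
      then obtain v where v: "v \<in> ?U" "\<not> dwin (dominating n es) (?U - {v}) D True" ..
      then have "stal_wins n es D (insert v S) True"
        using less.hyps[OF dec(2)[OF v(1)]] less.prems eq by auto
      then show ?thesis using False v by (auto intro: sw_smove)
    next
      case True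
      have "stal_wins n es (insert v D) S False" if v: "v \<in> ?U" for v
        using less.hyps[OF dec(1)[OF v]] less.prems eq v True
          dwin_TrueI[of ?U v "dominating n es" D] by auto
      then show ?thesis using True ne by (auto intro!: sw_dmove)
    qed
  qed
qed

section \<open>Domination of a vertex subset and deletion of a pendant pair\<close>

text \<open>Relativised domination: induced subgraphs are played on as subsets of one ambient graph,
  without relabelling.\<close>

definition covers :: "('a \<Rightarrow> 'a \<Rightarrow> bool) \<Rightarrow> 'a set \<Rightarrow> 'a set \<Rightarrow> bool" where
  "covers N A D \<longleftrightarrow> (\<forall>v\<in>A. \<exists>u\<in>D. u = v \<or> N u v)"

text \<open>The vertex \<open>w\<close> is the only possible neighbour of \<open>b\<close> in \<open>A\<close>; it may lie outside \<open>A\<close>,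
  in which case \<open>b\<close> has no neighbour in \<open>A\<close>.\<close>

locale pendant_pair =
  fixes N :: "'a \<Rightarrow> 'a \<Rightarrow> bool" and A :: "'a set" and a b w :: 'a
  assumes finite_A: "finite A"
    and new: "a \<notin> A" "b \<notin> A" "a \<noteq> b"
    and N_ab: "N a b" "N b a"
    and N_a: "\<And>v. v \<in> A \<Longrightarrow> \<not> N a v" "\<And>v. v \<in> A \<Longrightarrow> \<not> N v a"
    and N_b: "\<And>v. v \<in> A \<Longrightarrow> N b v \<Longrightarrow> v = w"
begin

abbreviation "W \<equiv> covers N (insert a (insert b A))"
abbreviation "W' \<equiv> covers N A"

lemma extend_cover: "c \<in> {a, b} \<Longrightarrow> W' D \<Longrightarrow> D \<subseteq> D' \<Longrightarrow> c \<in> D' \<Longrightarrow> W D'"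
  unfolding covers_def using N_ab by (metis insert_iff singletonD subsetD)

lemma restrict_cover_a: "W (insert a D) \<Longrightarrow> D \<subseteq> A \<Longrightarrow> W' D"
  unfolding covers_def using N_a new by (metis insert_iff)

lemma restrict_cover_b:
  "W D' \<Longrightarrow> D' \<subseteq> insert a (insert b D) \<Longrightarrow> D \<subseteq> A \<Longrightarrow> w \<in> A \<longrightarrow> w \<in> D \<Longrightarrow> W' D"
  unfolding covers_def using N_a N_b new by (smt (verit, best) insert_iff subsetD)

lemma not_W: "a \<notin> D \<Longrightarrow> b \<notin> D \<Longrightarrow> D \<subseteq> A \<Longrightarrow> \<not> W D"
  unfolding covers_def using N_a by blast

text \<open>Play on \<open>U\<close> follows the small game; the pair stays untouched until Staller
  enters it or \<open>U\<close> runs out, and either of its vertices dominates both.\<close>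

lemma dwin_add_pair:
  assumes "U \<subseteq> A" "dwin W' U D p"
  shows "dwin W (insert a (insert b U)) D p"
proof -
  have "finite U" using assms finite_A finite_subset by blast
  then show ?thesis using assms
  proof (induction U arbitrary: D p rule: finite_psubset_induct)
    case (psubset U)
    let ?V = "insert a (insert b U)"
    have fin: "finite ?V" using psubset.hyps by simp
    have nin: "a \<notin> U" "b \<notin> U" using psubset.prems new by auto
    have step: "dwin W U (insert c D) q" if "dwin W' U D q" "c \<in> {a, b}" for c q
      by (rule dwin_mono[OF psubset.hyps _ that(1)]) (rule extend_cover[OF that(2)], auto)
    show ?case
    proof (cases p)
      case True
      show ?thesis
      proof (cases "U = {}")
        case True
        \<comment> \<open>\<open>U\<close> is exhausted and Dominator has to open the pair himself;
          one of its vertices is enough, and Staller gets the other.\<close>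
        then have "W (insert a D)" using psubset.prems extend_cover[of a D "insert a D"] by auto
        moreover have "?V - {a} - {b} = {}" using True by auto
        ultimately have "dwin W (?V - {a} - {b}) (insert a D) True" by (metis dwin_empty)
        moreover have "?V - {a} = {b}" using True new by auto
        ultimately have "dwin W (?V - {a}) (insert a D) False"
          by (simp add: dwin_False)
        then show ?thesis using \<open>p\<close> fin by (auto intro: dwin_TrueI[of _ a])
      next
        case False
        then obtain v where v: "v \<in> U" "dwin W' (U - {v}) (insert v D) False"
          using psubset.prems \<open>p\<close> psubset.hyps by (auto simp: dwin_True)
        have "dwin W (insert a (insert b (U - {v}))) (insert v D) False"
          by (rule psubset.IH) (use v psubset.prems in auto)
        moreover have "insert a (insert b (U - {v})) = ?V - {v}" using v nin by auto
        ultimately show ?thesis using \<open>p\<close> fin v by (auto intro: dwin_TrueI[of _ v])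
      qed
    next
      case False
      have "dwin W (?V - {v}) D True" if v: "v \<in> ?V" for v
      proof (cases "v \<in> U")
        case True
        have "dwin W (insert a (insert b (U - {v}))) D True"
          by (rule psubset.IH)
            (use True psubset.prems psubset.hyps \<open>\<not> p\<close> in \<open>auto dest: dwin_FalseD\<close>)
        moreover have "insert a (insert b (U - {v})) = ?V - {v}" using True nin by auto
        ultimately show ?thesis by simp
      next
        case False
        define c where "c = (if v = a then b else a)"
        have "?V - {v} - {c} = U" "c \<in> ?V - {v}" "c \<in> {a, b}"
          using False v nin new by (auto simp: c_def)
        moreover have "dwin W U (insert c D) False"
          using step[of False c] psubset.prems \<open>\<not> p\<close> \<open>c \<in> {a, b}\<close> by simp
        ultimately show ?thesis using fin by (intro dwin_TrueI[of _ c]) auto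
      qed
      then have "dwin W ?V D False" using fin by (intro dwin_FalseI) auto
      then show ?thesis using False by simp
    qed
  qed
qed

text \<open>The forced reply \<open>a\<close> dominates nothing in \<open>A\<close>, and the turn is
  Staller's again. \<open>D\<close> is kept general because Dominator may already have moved in
  \<open>A\<close>.\<close>

lemma dwin_remove_pair_False:
  assumes "U \<subseteq> A" "D \<subseteq> A" "dwin W (insert a (insert b U)) D False"
  shows "dwin W' U D False"
proof -
  have fin: "finite U" using assms finite_A finite_subset by blast
  have nin: "a \<notin> U" "b \<notin> U" using assms new by auto
  have "insert a (insert b U) - {b} = insert a U" using nin new by auto
  then have "dwin W (insert a U) D True"
    using dwin_FalseD[OF assms(3), of b] fin by simp
  then obtain v where v: "v \<in> insert a U" "dwin W (insert a U - {v}) (insert v D) False"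
    using fin by (auto elim: dwin_TrueE)
  have "v = a"
  proof (rule ccontr)
    assume "v \<noteq> a"
    then have "dwin W (insert a U - {v} - {a}) (insert v D) True"
      using dwin_FalseD[OF v(2), of a] fin by auto
    moreover have "\<not> dwin W (insert a U - {v} - {a}) (insert v D) True"
    proof (rule not_dwin_surely)
      show "\<not> W (insert v D \<union> X)" if "X \<subseteq> insert a U - {v} - {a}" for X
        by (rule not_W) (use that v \<open>v \<noteq> a\<close> assms new in auto)
    qed (use fin in auto)
    ultimately show False by simp
  qed
  then have "dwin W U (insert a D) False" using v nin by simp
  then show ?thesis
  proof (rule dwin_mono[OF fin, rotated])
    show "W' (D \<union> X)" if "X \<subseteq> U" "W (insert a D \<union> X)" for X
      by (rule restrict_cover_a) (use that assms in auto)
  qed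
qed

text \<open>If Dominator takes \<open>b\<close>, he might as well have taken \<open>w\<close> in the smaller game:
  Staller answers \<open>w\<close> by \<open>a\<close> and \<open>a\<close> by \<open>w\<close>.\<close>

lemma dwin_swap:
  assumes "U \<subseteq> A" "D \<subseteq> A" "w \<in> A" "w \<notin> U"
    and "dwin W (insert a (insert w U)) (insert b D) p"
  shows "dwin W' U (insert w D) p"
proof -
  have "finite U" using assms finite_A finite_subset by blast
  then show ?thesis using assms
  proof (induction U arbitrary: D p rule: finite_psubset_induct)
    case (psubset U)
    let ?V = "insert a (insert w U)"
    have fin: "finite ?V" using psubset.hyps by simp
    have nin: "a \<notin> U" "b \<notin> U" "a \<noteq> w" using psubset.prems new by auto
    \<comment> \<open>Together with \<open>b\<close>, whichever of \<open>a\<close> and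
      \<open>w\<close> Dominator got dominates nothing in \<open>A\<close> that \<open>w\<close>
      alone does not.\<close>
    have swap: "dwin W' U (insert w D) q"
      if "dwin W U (insert c (insert b D)) q" "c \<in> {a, w}" for c q
    proof (rule dwin_mono[OF psubset.hyps _ that(1)])
      show "W' (insert w D \<union> X)" if X: "X \<subseteq> U" "W (insert c (insert b D) \<union> X)" for X
        by (rule restrict_cover_b[OF X(2)]) (use psubset.prems X(1) \<open>c \<in> {a, w}\<close> in auto)
    qed
    show ?case
    proof (cases p)
      case True
      then obtain v where v: "v \<in> ?V" "dwin W (?V - {v}) (insert v (insert b D)) False"
        using psubset.prems(5) fin by (auto elim: dwin_TrueE)
      show ?thesis
      proof (cases "v \<in> U")
        case True
        have "dwin W' (U - {v}) (insert w (insert v D)) False"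
        proof (rule psubset.IH)
          have "?V - {v} = insert a (insert w (U - {v}))" using True psubset.prems nin by auto
          then show "dwin W (insert a (insert w (U - {v}))) (insert b (insert v D)) False"
            using v by (simp add: insert_commute)
        qed (use True psubset.prems in auto)
        then show ?thesis using True psubset.hyps \<open>p\<close>
          by (auto intro!: dwin_TrueI[of _ v] simp: insert_commute)
      next
        case False
        define c where "c = (if v = a then w else a)"
        have c: "?V - {v} - {c} = U" "c \<in> ?V - {v}" "v \<in> {a, w}"
          using False v nin psubset.prems by (auto simp: c_def)
        then have "dwin W U (insert v (insert b D)) True"
          using dwin_FalseD[OF v(2), of c] fin by auto
        then show ?thesis using swap[of v True] c(3) \<open>p\<close> by simp
      qed
    next
      case False
      show ?thesis
      proof (cases "U = {}")
        case True
        then have "?V - {w} = {a}" using nin by auto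
        then have "dwin W {a} (insert b D) True"
          using dwin_FalseD[of W ?V "insert b D" w] psubset.prems(5) False fin
          by (metis insertI1 insert_iff)
        then have "dwin W U (insert a (insert b D)) False"
          using True by (auto simp: dwin_True)
        then show ?thesis using swap[of a] False by simp
      next
        case ne: False
        have "dwin W' (U - {v}) (insert w D) True" if v: "v \<in> U" for v
        proof (rule psubset.IH)
          have "?V - {v} = insert a (insert w (U - {v}))" using v psubset.prems nin by auto
          then show "dwin W (insert a (insert w (U - {v}))) (insert b D) True"
            using dwin_FalseD[of W ?V "insert b D" v] psubset.prems False fin v by auto
        qed (use v psubset.prems in auto)
        then show ?thesis using False ne psubset.hyps by (simp add: dwin_False)
      qed
    qed
  qed
qed

text \<open>Dominator's opening decides. In \<open>A\<close>: Staller then forces the pair as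
  before. At \<open>a\<close>: Staller takes \<open>b\<close>, and the opening has gained nothing in
  \<open>A\<close>. At \<open>b\<close>: the opening is replaced by \<open>w\<close>, or is
  worthless if \<open>w\<close> lies outside \<open>A\<close>.\<close>

lemma dwin_remove_pair_True:
  assumes "dwin W (insert a (insert b A)) {} True"
  shows "dwin W' A {} True"
proof -
  let ?V = "insert a (insert b A)"
  have fin: "finite ?V" using finite_A by simp
  obtain v where v: "v \<in> ?V" "dwin W (?V - {v}) {v} False"
    using assms fin by (auto elim: dwin_TrueE)
  have reply: "dwin W' A {} True" if "dwin W A {v} True" "v = a \<or> v = b \<and> w \<notin> A"
  proof (rule dwin_mono[OF finite_A _ that(1)])
    show "W' ({} \<union> X)" if X: "X \<subseteq> A" "W ({v} \<union> X)" for X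
      using \<open>v = a \<or> v = b \<and> w \<notin> A\<close>
    proof
      assume "v = a"
      then show ?thesis using X restrict_cover_a[of X] by simp
    next
      assume "v = b \<and> w \<notin> A"
      then show ?thesis using X restrict_cover_b[OF X(2), of X] by auto
    qed
  qed
  consider "v \<in> A" | "v = a" | "v = b" using v by auto
  then show ?thesis
  proof cases
    case 1
    then have "?V - {v} = insert a (insert b (A - {v}))" using new by auto
    then have "dwin W' (A - {v}) {v} False"
      using v 1 by (intro dwin_remove_pair_False) auto
    then show ?thesis using 1 finite_A by (auto intro: dwin_TrueI)
  next
    case 2
    then have "?V - {v} - {b} = A" using new by auto
    then show ?thesis using reply dwin_FalseD[OF v(2), of b] 2 fin new by auto
  next
    case 3
    then have eq: "?V - {v} - {a} = A" "?V - {v} = insert a A" using new by auto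
    show ?thesis
    proof (cases "w \<in> A")
      case True
      have "insert a A = insert a (insert w (A - {w}))" using True by auto
      then have "dwin W' (A - {w}) {w} False"
        using True v 3 eq by (intro dwin_swap) auto
      then show ?thesis using True finite_A by (auto intro: dwin_TrueI)
    next
      case False
      then show ?thesis using reply dwin_FalseD[OF v(2), of a] 3 fin new eq by auto
    qed
  qed
qed

theorem dwin_pendant_pair:
  "dwin W (insert a (insert b A)) {} p \<longleftrightarrow> dwin W' A {} p"
  using dwin_add_pair[of A "{}"] dwin_remove_pair_False[of A "{}"] dwin_remove_pair_True
  by (cases p) auto

end

text \<open>Once Staller holds \<open>v\<close>, the vertices \<open>x\<close> and \<open>y\<close>
  can be dominated only by being taken themselves; one reply saves at most one of them.
  \<open>D\<close> and \<open>U\<close> are general so that Dominator may have moved elsewhere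
  first.\<close>

lemma not_dwin_cherry:
  assumes "finite U" "v \<in> U" "x \<in> U" "y \<in> U" "v \<noteq> x" "v \<noteq> y" "x \<noteq> y"
    and "x \<in> A" "y \<in> A" "D \<inter> {v, x, y} = {}" "D \<union> U \<subseteq> A"
    and leaf: "\<And>u. u \<in> A \<Longrightarrow> N u x \<or> N u y \<Longrightarrow> u = v"
  shows "\<not> dwin (covers N A) U D False"
proof
  let ?W = "covers N A"
  assume "dwin ?W U D False"
  then have "dwin ?W (U - {v}) D True" using assms by (auto dest: dwin_FalseD)
  then obtain z where z: "z \<in> U - {v}" "dwin ?W (U - {v} - {z}) (insert z D) False"
    using assms by (subst (asm) dwin_True) auto
  define l where "l = (if z = x then y else x)"
  have l: "l \<in> U - {v} - {z}" "l \<in> A" "l \<notin> insert z D" "l = x \<or> l = y"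
    using assms z by (auto simp: l_def)
  have "dwin ?W (U - {v} - {z} - {l}) (insert z D) True"
    using dwin_FalseD[OF z(2) _ l(1)] assms by auto
  moreover have "\<not> dwin ?W (U - {v} - {z} - {l}) (insert z D) True"
  proof (rule not_dwin_surely)
    fix X assume X: "X \<subseteq> U - {v} - {z} - {l}"
    have "\<not> (\<exists>u\<in>insert z D \<union> X. u = l \<or> N u l)"
    proof
      assume "\<exists>u\<in>insert z D \<union> X. u = l \<or> N u l"
      then obtain u where u: "u \<in> insert z D \<union> X" "u = l \<or> N u l" by auto
      then have "u \<noteq> l" using X l by auto
      then have "u = v" using u leaf[of u] l X assms z by auto
      then show False using u X assms z by auto
    qed
    then show "\<not> ?W (insert z D \<union> X)" using l unfolding covers_def by auto
  qed (use assms in auto)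
  ultimately show False by simp
qed

section \<open>Residual trees\<close>

text \<open>Edges are identified with their positions in the edge list.\<close>

definition inner :: "(nat \<times> nat) list \<Rightarrow> nat set \<Rightarrow> nat set" where
  "inner es A = {i. i < length es \<and> fst (es ! i) \<in> A \<and> snd (es ! i) \<in> A}"

definition inc :: "(nat \<times> nat) list \<Rightarrow> nat set \<Rightarrow> nat \<Rightarrow> nat set" where
  "inc es A v = {i \<in> inner es A. fst (es ! i) = v \<or> snd (es ! i) = v}"

definition deg :: "(nat \<times> nat) list \<Rightarrow> nat set \<Rightarrow> nat \<Rightarrow> nat" where
  "deg es A v = card (inc es A v)"

text \<open>Both ends of an inner edge have degree at least 1, so the bound says that one end is a
  leaf and the other has degree at most 2. A sum makes this a single comparison on the
  machine.\<close>

definition removable :: "(nat \<times> nat) list \<Rightarrow> nat set \<Rightarrow> nat \<Rightarrow> bool" where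
  "removable es A i \<longleftrightarrow> i \<in> inner es A \<and> deg es A (fst (es ! i)) + deg es A (snd (es ! i)) \<le> 3"

lemma finite_inner [simp]: "finite (inner es A)"
  by (simp add: inner_def)

lemma finite_inc [simp]: "finite (inc es A v)"
  by (simp add: inc_def)

lemma adj_iff_nth: "adj es u v \<longleftrightarrow> (\<exists>i < length es. es ! i = (u, v) \<or> es ! i = (v, u))"
  unfolding adj_def in_set_conv_nth by blast

lemma adj_sym: "adj es u v \<longleftrightarrow> adj es v u"
  unfolding adj_def by auto

lemma adj_imp_inc:
  assumes "adj es u v" "u \<in> A" "v \<in> A"
  obtains i where "i \<in> inc es A u" "i \<in> inc es A v" "{fst (es ! i), snd (es ! i)} = {u, v}"
  using assms unfolding adj_iff_nth inc_def inner_def by fastforce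

lemma inner_imp_adj: "i \<in> inner es A \<Longrightarrow> adj es (fst (es ! i)) (snd (es ! i))"
  unfolding adj_iff_nth inner_def by force

lemma dominating_eq_covers: "dominating n es = covers (adj es) {0..<n}"
  unfolding dominating_def covers_def by (auto simp: fun_eq_iff)

text \<open>\<open>sparse\<close> is acyclicity in counting form; for two-element \<open>X\<close>
  it also excludes parallel entries in the edge list.\<close>

locale forest =
  fixes n :: nat and es :: "(nat \<times> nat) list"
  assumes endpoints: "i < length es \<Longrightarrow> fst (es ! i) < n \<and> snd (es ! i) < n \<and> fst (es ! i) \<noteq> snd (es ! i)"
    and sparse: "X \<subseteq> {0..<n} \<Longrightarrow> X \<noteq> {} \<Longrightarrow> card (inner es X) < card X"
begin

definition treelike :: "nat set \<Rightarrow> bool" where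
  "treelike A \<longleftrightarrow> A \<subseteq> {0..<n} \<and> (A = {} \<or> card (inner es A) + 1 = card A)"

lemma loopfree: "i \<in> inner es A \<Longrightarrow> fst (es ! i) \<noteq> snd (es ! i)"
  using endpoints unfolding inner_def by blast

lemma inc_unique:
  assumes "i \<in> inc es A a \<inter> inc es A b" "j \<in> inc es A a \<inter> inc es A b" "a \<noteq> b"
  shows "i = j"
proof (rule ccontr)
  assume "i \<noteq> j"
  have "{i, j} \<subseteq> inner es {a, b}" "a < n" "b < n"
    using assms endpoints[of i] endpoints[of j] unfolding inc_def inner_def by auto
  then have "2 \<le> card (inner es {a, b})"
    using \<open>i \<noteq> j\<close> card_mono[of "inner es {a, b}" "{i, j}"] by simp
  moreover have "card (inner es {a, b}) < card {a, b}"
    by (rule sparse) (use \<open>a < n\<close> \<open>b < n\<close> in auto)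
  ultimately show False using assms(3) by simp
qed

lemma card_inner_remove: "card (inner es A) = card (inner es (A - {v})) + deg es A v"
proof -
  have "inner es A = inner es (A - {v}) \<union> inc es A v" "inner es (A - {v}) \<inter> inc es A v = {}"
    unfolding inner_def inc_def by auto
  then show ?thesis unfolding deg_def by (metis card_Un_disjoint finite_inc finite_inner)
qed

text \<open>Handshake lemma, by double counting; loop-freeness makes every edge count twice.\<close>

lemma sum_deg:
  assumes "finite A"
  shows "(\<Sum>v\<in>A. deg es A v) = 2 * card (inner es A)"
proof -
  have "deg es A v = (\<Sum>i\<in>inner es A. of_bool (v = fst (es ! i) \<or> v = snd (es ! i)))" for v
    unfolding deg_def inc_def by (auto simp: sum.If_cases of_bool_def Int_def intro!: arg_cong[of _ _ card])
  then have "(\<Sum>v\<in>A. deg es A v) =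
      (\<Sum>i\<in>inner es A. \<Sum>v\<in>A. of_bool (v = fst (es ! i) \<or> v = snd (es ! i)))"
    by (simp add: sum.swap[of _ A])
  also have "\<dots> = (\<Sum>i\<in>inner es A. 2)"
  proof (rule sum.cong)
    fix i assume i: "i \<in> inner es A"
    have "A \<inter> {v. v = fst (es ! i) \<or> v = snd (es ! i)} = {fst (es ! i), snd (es ! i)}"
      using i unfolding inner_def by auto
    then show "(\<Sum>v\<in>A. of_bool (v = fst (es ! i) \<or> v = snd (es ! i))) = (2::nat)"
      using assms loopfree[OF i] by (simp add: sum.If_cases of_bool_def)
  qed simp
  finally show ?thesis by simp
qed

text \<open>Removing an isolated vertex would leave \<open>|A| - 1\<close> edges on
  \<open>|A| - 1\<close> vertices, against \<open>sparse\<close>.\<close>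

lemma deg_pos:
  assumes "treelike A" "2 \<le> card A" "v \<in> A"
  shows "1 \<le> deg es A v"
proof -
  have "A \<noteq> {v}" using assms by auto
  then have "card (inner es (A - {v})) < card (A - {v})"
    using assms by (intro sparse) (auto simp: treelike_def)
  moreover have "card (A - {v}) = card A - 1" using assms by simp
  moreover have "card (inner es A) + 1 = card A" using assms by (auto simp: treelike_def)
  ultimately show ?thesis using card_inner_remove[of A v] by linarith
qed

text \<open>Two vertices go, and with them \<open>deg a + deg b - 1\<close>, hence at most two,
  edges. So at least \<open>|A| - 3\<close> edges remain, and \<open>sparse\<close> allows no more
  on \<open>|A| - 2\<close> vertices unless none are left.\<close>

lemma treelike_remove:
  assumes "treelike A" "removable es A i"
  shows "treelike (A - {fst (es ! i), snd (es ! i)})"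
proof -
  define a b where "a = fst (es ! i)" and "b = snd (es ! i)"
  have i: "i \<in> inner es A" and d: "deg es A a + deg es A b \<le> 3"
    using assms unfolding removable_def a_def b_def by auto
  have ab: "a \<in> A" "b \<in> A" "a \<noteq> b"
    using i loopfree[OF i] unfolding inner_def a_def b_def by auto
  have fin: "finite A" using assms unfolding treelike_def by (auto intro: finite_subset)
  have ii: "i \<in> inc es A a \<inter> inc es A b" using i unfolding inc_def a_def b_def by auto
  \<comment> \<open>Only \<open>i\<close> joins \<open>a\<close> and \<open>b\<close>, so deleting
    \<open>a\<close> costs \<open>b\<close> exactly one edge.\<close>
  have "inc es (A - {a}) b = inc es A b - {i}"
  proof
    show "inc es (A - {a}) b \<subseteq> inc es A b - {i}"
      unfolding inc_def inner_def a_def by auto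
    show "inc es A b - {i} \<subseteq> inc es (A - {a}) b"
    proof
      fix j assume j: "j \<in> inc es A b - {i}"
      then have "j \<notin> inc es A a" using inc_unique[OF ii, of j] ab by blast
      then show "j \<in> inc es (A - {a}) b" using j ab unfolding inc_def inner_def by auto
    qed
  qed
  then have "deg es (A - {a}) b + 1 = deg es A b"
    using ii card_Suc_Diff1[of "inc es A b" i] unfolding deg_def by simp
  then have eq: "card (inner es A) + 1 = card (inner es (A - {a} - {b})) + deg es A a + deg es A b"
    using card_inner_remove[of A a] card_inner_remove[of "A - {a}" b] by simp
  have "deg es A a \<ge> 1" "deg es A b \<ge> 1"
    using ii unfolding deg_def by (auto simp: Suc_le_eq card_gt_0_iff)
  have "card (A - {a} - {b}) + 2 = card A"
    using ab fin card_Suc_Diff1[of A a] card_Suc_Diff1[of "A - {a}" b] by simp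
  moreover have "card (inner es A) + 1 = card A" using assms ab by (auto simp: treelike_def)
  moreover have "A - {a} - {b} \<noteq> {} \<Longrightarrow> card (inner es (A - {a} - {b})) < card (A - {a} - {b})"
    using assms by (intro sparse) (auto simp: treelike_def)
  ultimately have "A - {a} - {b} = {} \<or> card (inner es (A - {a} - {b})) + 1 = card (A - {a} - {b})"
    using eq d by linarith
  moreover have "A - {a, b} = A - {a} - {b}" by auto
  ultimately show ?thesis
    using assms unfolding treelike_def a_def[symmetric] b_def[symmetric] by auto
qed

lemma pendant_pairI:
  assumes "A \<subseteq> {0..<n}" "i \<in> inc es A a \<inter> inc es A b" "a \<noteq> b" "deg es A a \<le> 1" "deg es A b \<le> 2"
  obtains w where "pendant_pair (adj es) (A - {a, b}) a b w"
proof -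
  let ?B = "A - {a, b}"
  have ab: "a \<in> A" "b \<in> A" "adj es a b"
    using assms(2,3) inner_imp_adj[of i es A] adj_sym[of es] unfolding inc_def inner_def by auto
  have fin: "finite A" using assms(1) finite_subset by blast
  have inc_a: "inc es A a = {i}"
    using assms(2,4) card_le_Suc0_iff_eq[of "inc es A a"] unfolding deg_def by auto
  have N_a: "\<not> adj es a v" if v: "v \<in> ?B" for v
  proof
    assume "adj es a v"
    then obtain j where "j \<in> inc es A a" "{fst (es ! j), snd (es ! j)} = {a, v}"
      using adj_imp_inc[of es a v A] ab v by auto
    then have "b \<in> {a, v}" using inc_a assms(2) unfolding inc_def by auto
    then show False using v assms(3) by auto
  qed
  have N_b: "u = v" if u: "u \<in> ?B" "adj es b u" and v: "v \<in> ?B" "adj es b v" for u v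
  proof (rule ccontr)
    assume "u \<noteq> v"
    obtain j where j: "j \<in> inc es A b" "{fst (es ! j), snd (es ! j)} = {b, u}"
      using adj_imp_inc[of es b u A] ab u by auto
    obtain k where k: "k \<in> inc es A b" "{fst (es ! k), snd (es ! k)} = {b, v}"
      using adj_imp_inc[of es b v A] ab v by auto
    have "a \<in> {fst (es ! i), snd (es ! i)}" using assms(2) unfolding inc_def by auto
    \<comment> \<open>Two further neighbours of \<open>b\<close> would give it three edges: to
      \<open>a\<close>, \<open>u\<close> and \<open>v\<close>.\<close>
    then have "i \<noteq> j" "i \<noteq> k" "j \<noteq> k"
      using j k u v \<open>u \<noteq> v\<close> assms(3) by (auto simp: doubleton_eq_iff)
    then have "3 \<le> card {i, j, k}" by simp
    also have "\<dots> \<le> deg es A b"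
      unfolding deg_def by (rule card_mono) (use j k assms(2) in auto)
    finally show False using assms(5) by simp
  qed
  \<comment> \<open>If \<open>b\<close> has no neighbour besides \<open>a\<close>, this value is
    arbitrary and the condition on it is vacuous.\<close>
  define w where "w = (SOME v. v \<in> ?B \<and> adj es b v)"
  have "pendant_pair (adj es) ?B a b w"
  proof
    show "v = w" if "v \<in> ?B" "adj es b v" for v
      using N_b someI[of "\<lambda>v. v \<in> ?B \<and> adj es b v" v] that unfolding w_def by blast
  qed (use fin ab assms(3) N_a adj_sym[of es] in auto)
  then show thesis by (rule that)
qed

lemma dwin_remove:
  assumes "treelike A" "removable es A i"
  shows "dwin (covers (adj es) A) A {} p \<longleftrightarrow>
    dwin (covers (adj es) (A - {fst (es ! i), snd (es ! i)})) (A - {fst (es ! i), snd (es ! i)}) {} p"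
proof -
  let ?a = "fst (es ! i)" and ?b = "snd (es ! i)"
  have i: "i \<in> inner es A" and d: "deg es A ?a + deg es A ?b \<le> 3"
    using assms unfolding removable_def by auto
  have ii: "i \<in> inc es A ?a \<inter> inc es A ?b" using i unfolding inc_def by auto
  have A: "A \<subseteq> {0..<n}" using assms unfolding treelike_def by auto
  have ge: "deg es A ?a \<ge> 1" "deg es A ?b \<ge> 1"
    using ii unfolding deg_def by (auto simp: Suc_le_eq card_gt_0_iff)
  have ab: "?a \<in> A" "?b \<in> A" using i unfolding inner_def by auto
  consider "deg es A ?a \<le> 1" "deg es A ?b \<le> 2" | "deg es A ?b \<le> 1" "deg es A ?a \<le> 2"
    using d ge by linarith
  then show ?thesis
  proof cases
    case 1
    obtain w where "pendant_pair (adj es) (A - {?a, ?b}) ?a ?b w"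
      using pendant_pairI[OF A ii loopfree[OF i] 1] .
    moreover have "insert ?a (insert ?b (A - {?a, ?b})) = A" using ab by auto
    ultimately show ?thesis using pendant_pair.dwin_pendant_pair[of "adj es" "A - {?a, ?b}"] by metis
  next
    case 2
    have ii': "i \<in> inc es A ?b \<inter> inc es A ?a" using ii by auto
    obtain w where "pendant_pair (adj es) (A - {?b, ?a}) ?b ?a w"
      using pendant_pairI[OF A ii' loopfree[OF i, symmetric] 2] .
    moreover have "insert ?b (insert ?a (A - {?b, ?a})) = A" using ab by auto
    moreover have "A - {?b, ?a} = A - {?a, ?b}" by auto
    ultimately show ?thesis using pendant_pair.dwin_pendant_pair[of "adj es" "A - {?b, ?a}"] by metis
  qed
qed

section \<open>Leaves, interior and cherries of a residual tree\<close>

definition internal :: "nat set \<Rightarrow> nat set" where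
  "internal A = {v \<in> A. 2 \<le> deg es A v}"

text \<open>The degrees at the ends of an edge that is not removable add up to at least 4.\<close>

lemma leaf_edge_other_end:
  assumes "\<And>i. \<not> removable es A i" "i \<in> inner es A" "deg es A (fst (es ! i)) \<le> 1 \<or> deg es A (snd (es ! i)) \<le> 1"
  shows "3 \<le> deg es A (fst (es ! i)) \<or> 3 \<le> deg es A (snd (es ! i))"
  using assms(1)[of i] assms(2,3) unfolding removable_def by linarith

text \<open>No edge joins two leaves, so deleting all leaves removes exactly one edge per leaf.\<close>

lemma internal_count:
  assumes "treelike A" "2 \<le> card A" "\<And>i. \<not> removable es A i"
  shows "card (inner es (internal A)) + 1 = card (internal A)"
proof -
  define L where "L = {v \<in> A. deg es A v = 1}"
  have fin: "finite A" using assms unfolding treelike_def by (auto intro: finite_subset)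
  have part: "A = internal A \<union> L" "internal A \<inter> L = {}"
    using deg_pos[OF assms(1,2)] unfolding internal_def L_def by force+
  have cA: "card A = card (internal A) + card L"
    using part fin by (metis card_Un_disjoint finite_Un)
  have "inner es A = inner es (internal A) \<union> (\<Union>v\<in>L. inc es A v)"
  proof
    show "inner es A \<subseteq> inner es (internal A) \<union> (\<Union>v\<in>L. inc es A v)"
      using part unfolding inner_def inc_def by auto
    show "inner es (internal A) \<union> (\<Union>v\<in>L. inc es A v) \<subseteq> inner es A"
      unfolding inner_def inc_def internal_def by auto
  qed
  moreover have "inner es (internal A) \<inter> (\<Union>v\<in>L. inc es A v) = {}"
    using part unfolding inner_def inc_def by auto
  moreover have "finite L" using fin unfolding L_def by simp
  ultimately have "card (inner es A) = card (inner es (internal A)) + card (\<Union>v\<in>L. inc es A v)"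
    by (metis card_Un_disjoint finite_inner finite_Un)
  moreover have "card (\<Union>v\<in>L. inc es A v) = (\<Sum>v\<in>L. card (inc es A v))"
  proof (rule card_UN_disjoint)
    show "\<forall>u\<in>L. \<forall>v\<in>L. u \<noteq> v \<longrightarrow> inc es A u \<inter> inc es A v = {}"
    proof (intro ballI impI, rule ccontr)
      fix u v assume uv: "u \<in> L" "v \<in> L" "u \<noteq> v" "inc es A u \<inter> inc es A v \<noteq> {}"
      then obtain i where i: "i \<in> inner es A" "{fst (es ! i), snd (es ! i)} = {u, v}"
        unfolding inc_def by auto
      then have "deg es A (fst (es ! i)) = 1" "deg es A (snd (es ! i)) = 1"
        using uv unfolding L_def by (auto simp: doubleton_eq_iff)
      then show False using leaf_edge_other_end[OF assms(3) i(1)] by simp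
    qed
  qed (use \<open>finite L\<close> in auto)
  moreover have "(\<Sum>v\<in>L. card (inc es A v)) = card L"
    unfolding L_def deg_def by simp
  moreover have "card (inner es A) + 1 = card A" using assms by (auto simp: treelike_def)
  ultimately show ?thesis using cA by linarith
qed

text \<open>The double threat. Having \<open>v\<close> inside and \<open>x\<close>, \<open>y\<close>
  outside \<open>internal A\<close> is what makes cherries with different centres disjoint.\<close>

definition cherry :: "nat set \<Rightarrow> nat \<Rightarrow> nat \<Rightarrow> nat \<Rightarrow> bool" where
  "cherry A v x y \<longleftrightarrow> x \<noteq> y \<and> v \<in> internal A \<and> {x, y} \<subseteq> A - internal A \<and> adj es v x \<and> adj es v y
     \<and> (\<forall>u\<in>A. adj es u x \<or> adj es u y \<longrightarrow> u = v)"

lemma leaf_neighbour: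
  assumes "x \<in> A - internal A" "v \<in> A" "adj es v x" "u \<in> A" "adj es u x"
  shows "u = v"
proof -
  obtain i where i: "i \<in> inc es A x" "{fst (es ! i), snd (es ! i)} = {v, x}"
    using assms adj_imp_inc[of es v x A] by auto
  obtain j where j: "j \<in> inc es A x" "{fst (es ! j), snd (es ! j)} = {u, x}"
    using assms adj_imp_inc[of es u x A] by auto
  have "card (inc es A x) \<le> Suc 0" using assms(1) unfolding internal_def deg_def by auto
  then have "i = j" using i j by (simp add: card_le_Suc0_iff_eq)
  then show ?thesis using i j by (auto simp: doubleton_eq_iff)
qed

text \<open>At most one edge at \<open>v\<close> stays in the interior; the others, collected in
  \<open>F\<close>, lead to leaves. If \<open>F\<close> had fewer than two elements,
  \<open>v\<close> would have degree 2 and the edge to its single leaf would be removable.\<close>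

lemma ex_cherry:
  assumes "treelike A" "2 \<le> card A" "\<And>i. \<not> removable es A i"
    and v: "v \<in> internal A" "deg es (internal A) v \<le> 1"
  shows "\<exists>x y. cherry A v x y"
proof -
  let ?I = "internal A"
  have sub: "inc es ?I v \<subseteq> inc es A v" unfolding inc_def inner_def internal_def by auto
  have d2: "2 \<le> deg es A v" using v unfolding internal_def by auto
  define F where "F = inc es A v - inc es ?I v"
  have cF: "card F = deg es A v - deg es ?I v"
    unfolding F_def deg_def by (rule card_Diff_subset) (use sub in auto)
  have leaf: "\<exists>x. {fst (es ! j), snd (es ! j)} = {v, x} \<and> x \<in> A - ?I \<and> j \<in> inc es A x \<and> adj es v x"
    if "j \<in> F" for j
    using that v inner_imp_adj[of j es A] adj_sym[of es] unfolding F_def inc_def inner_def by auto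
  have "2 \<le> card F"
  proof (rule ccontr)
    assume "\<not> 2 \<le> card F"
    then have "deg es A v = 2" "card F > 0" using cF d2 v by linarith+
    then obtain j where j: "j \<in> F" by fastforce
    obtain x where x: "{fst (es ! j), snd (es ! j)} = {v, x}" "x \<in> A - ?I" using leaf[OF j] by auto
    have "deg es A x \<le> 1" using x unfolding internal_def by auto
    moreover have "j \<in> inner es A" using j unfolding F_def inc_def by auto
    ultimately show False
      using leaf_edge_other_end[OF assms(3), of j] x \<open>deg es A v = 2\<close> by (auto simp: doubleton_eq_iff)
  qed
  then have "\<not> card F \<le> Suc 0" "finite F" by (auto simp: F_def)
  then obtain j k where jk: "j \<in> F" "k \<in> F" "j \<noteq> k" by (auto simp: card_le_Suc0_iff_eq)
  obtain x where x: "{fst (es ! j), snd (es ! j)} = {v, x}" "x \<in> A - ?I" "j \<in> inc es A x" "adj es v x"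
    using leaf[OF jk(1)] by auto
  obtain y where y: "{fst (es ! k), snd (es ! k)} = {v, y}" "y \<in> A - ?I" "k \<in> inc es A y" "adj es v y"
    using leaf[OF jk(2)] by auto
  have "x \<noteq> y"
  proof
    assume "x = y"
    moreover have "x \<noteq> v" using x v by auto
    ultimately show False using inc_unique[of j A x v k] x y jk unfolding F_def by auto
  qed
  moreover have "u = v" if "u \<in> A" "adj es u x \<or> adj es u y" for u
    using leaf_neighbour[of x A v u] leaf_neighbour[of y A v u] x y v that unfolding internal_def by auto
  ultimately show ?thesis using x y v unfolding cherry_def by blast
qed

lemma not_dwin_cherryI:
  assumes "cherry A v x y" "finite U" "{v, x, y} \<subseteq> U" "D \<union> U \<subseteq> A" "D \<inter> {v, x, y} = {}"
  shows "\<not> dwin (covers (adj es) A) U D False"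
  by (rule not_dwin_cherry[of U v x y]) (use assms in \<open>auto simp: cherry_def\<close>)

lemma cherries_disjoint:
  assumes "cherry A v x y" "cherry A v' x' y'" "v \<noteq> v'"
  shows "{v, x, y} \<inter> {v', x', y'} = {}"
  using assms unfolding cherry_def internal_def by blast

text \<open>Dominator's opening meets at most one of two disjoint cherries; Staller plays on the
  other.\<close>

lemma not_dwin_two_cherries:
  assumes "cherry A v x y" "cherry A v' x' y'" "v \<noteq> v'" "finite A"
  shows "\<not> dwin (covers (adj es) A) A {} True"
proof
  assume "dwin (covers (adj es) A) A {} True"
  moreover have "A \<noteq> {}" using assms(1) unfolding cherry_def by auto
  ultimately obtain z where z: "z \<in> A" "dwin (covers (adj es) A) (A - {z}) {z} False"
    using assms(4) by (auto elim: dwin_TrueE)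
  have sub: "{v, x, y} \<subseteq> A" "{v', x', y'} \<subseteq> A"
    using assms(1,2) unfolding cherry_def internal_def by auto
  consider "z \<notin> {v, x, y}" | "z \<notin> {v', x', y'}" using cherries_disjoint[OF assms(1-3)] by blast
  then show False
  proof cases
    case 1
    then show False using not_dwin_cherryI[OF assms(1), of "A - {z}" "{z}"] sub z assms(4) by auto
  next
    case 2
    then show False using not_dwin_cherryI[OF assms(2), of "A - {z}" "{z}"] sub z assms(4) by auto
  qed
qed

text \<open>If all vertices but \<open>u\<close> had degree at least 2, the degree sum would be at
  least \<open>1 + 2 * (|I| - 1)\<close>, which exceeds twice the number of edges by one.\<close>

lemma two_ends:
  assumes "treelike I" "2 \<le> card I"
  shows "\<exists>u\<in>I. \<exists>v\<in>I. u \<noteq> v \<and> deg es I u \<le> 1 \<and> deg es I v \<le> 1"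
proof (rule ccontr)
  assume neg: "\<not> ?thesis"
  have fin: "finite I" using assms unfolding treelike_def by (auto intro: finite_subset)
  have ne: "I \<noteq> {}" using assms(2) by auto
  \<comment> \<open>\<open>u\<close> is the exceptional vertex of degree at most 1, or any vertex if
    there is none.\<close>
  have "\<exists>u\<in>I. \<forall>v\<in>I - {u}. 2 \<le> deg es I v"
  proof (cases "\<exists>u\<in>I. deg es I u \<le> 1")
    case True
    then show ?thesis using neg by (metis DiffE insertI1 not_less_eq_eq numeral_2_eq_2 One_nat_def)
  next
    case False
    then show ?thesis using ne by (metis DiffE ex_in_conv not_less_eq_eq numeral_2_eq_2 One_nat_def)
  qed
  then obtain u where u: "u \<in> I" "\<And>v. v \<in> I - {u} \<Longrightarrow> 2 \<le> deg es I v" by blast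
  have "(\<Sum>v\<in>I - {u}. 2) \<le> (\<Sum>v\<in>I - {u}. deg es I v)" by (rule sum_mono) (rule u(2))
  moreover have "(\<Sum>v\<in>I. deg es I v) = deg es I u + (\<Sum>v\<in>I - {u}. deg es I v)"
    using fin u(1) by (rule sum.remove)
  moreover have "1 \<le> deg es I u" using deg_pos[OF assms u(1)] .
  moreover have "card (inner es I) + 1 = card I" using assms ne unfolding treelike_def by auto
  moreover have "(\<Sum>v\<in>I - {u}. 2) = 2 * (card I - 1)" using u(1) fin by simp
  ultimately show False using sum_deg[OF fin] assms(2) by linarith
qed

text \<open>As \<open>A\<close> spans \<open>|A| - 1\<close> edges, the test says that some vertex
  meets all of them: \<open>A\<close> is a star or a single vertex. A deleted vertex has degree 0
  and can pass only if \<open>|A| = 1\<close>, where the answer is the same, so the test may range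
  over all \<open>v < n\<close>.\<close>

theorem residual_outcome:
  assumes A: "treelike A" "A \<noteq> {}" and no: "\<And>i. \<not> removable es A i"
  shows "\<not> dwin (covers (adj es) A) A {} False"
    and "dwin (covers (adj es) A) A {} True \<longleftrightarrow> (\<exists>v<n. card A \<le> deg es A v + 1)"
proof -
  let ?W = "covers (adj es) A"
  have fin: "finite A" and An: "A \<subseteq> {0..<n}"
    using A unfolding treelike_def by (auto intro: finite_subset)
  have "\<not> dwin ?W A {} False \<and> (dwin ?W A {} True \<longleftrightarrow> (\<exists>v<n. card A \<le> deg es A v + 1))"
  proof (cases "card A = 1")
    case True
    then obtain v where v: "A = {v}" by (meson card_1_singletonE)
    have "dwin ?W A {} True" "\<not> dwin ?W A {} False"
      unfolding v by (auto simp: dwin_True dwin_False covers_def)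
    moreover have "\<exists>v<n. card A \<le> deg es A v + 1" using True An v by auto
    ultimately show ?thesis by simp
  next
    case False
    then have c2: "2 \<le> card A" using fin \<open>A \<noteq> {}\<close>
      by (metis One_nat_def card_0_eq less_2_cases not_less)
    let ?I = "internal A"
    have IA: "?I \<subseteq> A" unfolding internal_def by auto
    have cI: "card (inner es ?I) + 1 = card ?I" by (rule internal_count[OF A(1) c2 no])
    have cA: "card (inner es A) + 1 = card A" using A unfolding treelike_def by auto
    show ?thesis
    proof (cases "card ?I = 1")
      case True
      then obtain v where v: "?I = {v}" by (meson card_1_singletonE)
      have vA: "v \<in> A" using v IA by auto
      \<comment> \<open>An edge avoiding \<open>v\<close> would join two leaves, but it is not
        removable.\<close>
      have all: "fst (es ! i) = v \<or> snd (es ! i) = v" if i: "i \<in> inner es A" for i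
      proof (rule ccontr)
        assume "\<not> ?thesis"
        then have "fst (es ! i) \<notin> ?I" "snd (es ! i) \<notin> ?I" using v by auto
        then show False using leaf_edge_other_end[OF no i] i unfolding internal_def inner_def by auto
      qed
      then have "inc es A v = inner es A" unfolding inc_def by auto
      then have "card A \<le> deg es A v + 1" using cA unfolding deg_def by simp
      moreover have "deg es ?I v \<le> 1"
        using cI True card_mono[of "inner es ?I" "inc es ?I v"] unfolding deg_def inc_def by auto
      then obtain x y where "cherry A v x y" using ex_cherry[OF A(1) c2 no, of v] v by auto
      then have "\<not> dwin ?W A {} False"
        using not_dwin_cherryI[of A v x y A "{}"] fin unfolding cherry_def internal_def by auto
      moreover have "dwin ?W (A - {v}) {v} False"
      proof (rule dwin_surely)
        fix X
        have "\<exists>u\<in>{v} \<union> X. u = x \<or> adj es u x" if x: "x \<in> A" for x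
        proof (cases "x = v")
          case False
          have "inc es A x \<noteq> {}" using deg_pos[OF A(1) c2 x] unfolding deg_def by auto
          then obtain i where i: "i \<in> inner es A" "fst (es ! i) = x \<or> snd (es ! i) = x"
            unfolding inc_def by auto
          then have "adj es v x" using all[OF i(1)] False inner_imp_adj[OF i(1)] adj_sym[of es] by auto
          then show ?thesis by auto
        qed auto
        then show "?W ({v} \<union> X)" unfolding covers_def by auto
      qed (use fin in auto)
      then have "dwin ?W A {} True" using fin vA by (auto intro: dwin_TrueI)
      moreover have "v < n" using vA An by auto
      ultimately show ?thesis by blast
    next
      case False
      \<comment> \<open>\<open>cI\<close> also rules out an empty interior.\<close>
      then have "2 \<le> card ?I" using cI by linarith
      then obtain u v where uv: "u \<in> ?I" "v \<in> ?I" "u \<noteq> v" "deg es ?I u \<le> 1" "deg es ?I v \<le> 1"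
        using two_ends[of ?I] cI IA An unfolding treelike_def by blast
      obtain x y where c1: "cherry A u x y" using ex_cherry[OF A(1) c2 no uv(1,4)] by auto
      obtain x' y' where c2: "cherry A v x' y'" using ex_cherry[OF A(1) c2 no uv(2,5)] by auto
      have "\<not> dwin ?W A {} False"
        using not_dwin_cherryI[OF c1, of A "{}"] c1 fin unfolding cherry_def internal_def by auto
      moreover have "\<not> dwin ?W A {} True" by (rule not_dwin_two_cherries[OF c1 c2 uv(3) fin])
      \<comment> \<open>A vertex on all edges would lie on one edge of each of two disjoint
        cherries.\<close>
      moreover have "\<not> card A \<le> deg es A z + 1" for z
      proof
        assume "card A \<le> deg es A z + 1"
        then have "card (inner es A) \<le> card (inc es A z)" using cA unfolding deg_def by simp
        then have eq: "inc es A z = inner es A"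
          by (intro card_seteq) (auto simp: inc_def)
        have on: "z \<in> {p, q}" if pq: "adj es p q" "p \<in> A" "q \<in> A" for p q
        proof -
          obtain i where i: "i \<in> inc es A p" "{fst (es ! i), snd (es ! i)} = {p, q}"
            using adj_imp_inc[OF pq] by metis
          then have "i \<in> inc es A z" using eq by (simp add: inc_def)
          then have "z \<in> {fst (es ! i), snd (es ! i)}" by (auto simp: inc_def)
          then show ?thesis using i by simp
        qed
        have "z \<in> {u, x}" by (rule on) (use c1 in \<open>auto simp: cherry_def internal_def\<close>)
        moreover have "z \<in> {v, x'}" by (rule on) (use c2 in \<open>auto simp: cherry_def internal_def\<close>)
        ultimately show False using cherries_disjoint[OF c1 c2 uv(3)] by blast
      qed
      ultimately show ?thesis by blast
    qed
  qed
  then show "\<not> dwin ?W A {} False" "dwin ?W A {} True \<longleftrightarrow> (\<exists>v<n. card A \<le> deg es A v + 1)"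
    by blast+
qed

end

section \<open>From connectedness to edge counting\<close>

lemma connected_extend:
  assumes "is_tree n es" "X \<subseteq> {0..<n}" "X \<noteq> {}" "X \<noteq> {0..<n}"
  obtains v where "v \<in> {0..<n} - X" "card (inner es X) + 1 \<le> card (inner es (insert v X))"
proof -
  obtain x y where xy: "x \<in> X" "y \<in> {0..<n} - X" using assms(2-4) by blast
  then have "(x, y) \<in> {(x, y). adj es x y}\<^sup>*"
    using assms unfolding is_tree_def by auto
  moreover have "y \<in> X" if "(x, y) \<in> {(x, y). adj es x y}\<^sup>*" "\<And>u v. u \<in> X \<Longrightarrow> adj es u v \<Longrightarrow> v \<in> X"
    using that xy(1) by (induction rule: rtrancl_induct) auto
  ultimately have "\<exists>u v. u \<in> X \<and> v \<notin> X \<and> adj es u v"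
    using xy by blast
  then obtain u v where uv: "u \<in> X" "v \<notin> X" "adj es u v" by blast
  then obtain i where i: "i < length es" "es ! i = (u, v) \<or> es ! i = (v, u)"
    unfolding adj_iff_nth by blast
  have "\<forall>e\<in>set es. fst e < n \<and> snd e < n" using assms(1) unfolding is_tree_def by auto
  then have "fst (es ! i) < n \<and> snd (es ! i) < n" using i(1) by simp
  then have "v < n" using i(2) by auto
  have "insert i (inner es X) \<subseteq> inner es (insert v X)" "i \<notin> inner es X"
    using i uv unfolding inner_def by auto
  then have "card (inner es X) + 1 \<le> card (inner es (insert v X))"
    using card_mono[of "inner es (insert v X)" "insert i (inner es X)"] by simp
  then show thesis using that[of v] uv \<open>v < n\<close> by auto
qed

text \<open>Growing \<open>X\<close> to the full vertex set along edges that leave it gains at least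
  one edge per vertex, and the full set has only \<open>n - 1\<close> edges.\<close>

lemma tree_sparse:
  assumes "is_tree n es" "X \<subseteq> {0..<n}" "X \<noteq> {}"
  shows "card (inner es X) < card X"
  using assms(2,3)
proof (induction "n - card X" arbitrary: X rule: less_induct)
  case less
  show ?case
  proof (cases "X = {0..<n}")
    case True
    have "card (inner es X) \<le> card {..<length es}"
      by (rule card_mono) (auto simp: inner_def)
    then show ?thesis using assms(1) True unfolding is_tree_def by auto
  next
    case False
    obtain v where v: "v \<in> {0..<n} - X" "card (inner es X) + 1 \<le> card (inner es (insert v X))"
      using connected_extend[OF assms(1) less.prems False] .
    have fin: "finite X" using less.prems finite_subset by blast
    have "card (insert v X) \<le> card {0..<n}" by (rule card_mono) (use v less.prems in auto)
    then have "n - card (insert v X) < n - card X" using v fin by simp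
    then have "card (inner es (insert v X)) < card (insert v X)"
      using v less.prems by (intro less.hyps) auto
    then show ?thesis using v fin by simp
  qed
qed

lemma tree_forest: "is_tree n es \<Longrightarrow> forest n es"
proof
  show "fst (es ! i) < n \<and> snd (es ! i) < n \<and> fst (es ! i) \<noteq> snd (es ! i)"
    if "is_tree n es" "i < length es" for i
    using that nth_mem[of i es] unfolding is_tree_def by (fastforce simp: case_prod_beta)
qed (rule tree_sparse)

lemma tree_treelike: "is_tree n es \<Longrightarrow> forest.treelike n es {0..<n}"
proof -
  assume t: "is_tree n es"
  have "inner es {0..<n} = {..<length es}"
    using forest.endpoints[OF tree_forest[OF t]] unfolding inner_def by auto
  then show ?thesis using t unfolding forest.treelike_def[OF tree_forest[OF t]] is_tree_def by auto
qed

section \<open>Vertex sets with the same winners as the whole tree\<close>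

context forest
begin

definition residual :: "nat set \<Rightarrow> bool" where
  "residual A \<longleftrightarrow> treelike A \<and>
     (\<forall>p. dwin (covers (adj es) A) A {} p \<longleftrightarrow> dwin (covers (adj es) {0..<n}) {0..<n} {} p)"

lemma residual_remove:
  "residual A \<Longrightarrow> removable es A i \<Longrightarrow> residual (A - {fst (es ! i), snd (es ! i)})"
  unfolding residual_def using treelike_remove dwin_remove by metis

lemma has_outcome_residual:
  assumes "residual A" "\<And>i. \<not> removable es A i"
  shows "has_outcome n es (if A = {} then OutD else if \<exists>v<n. card A \<le> deg es A v + 1 then OutN else OutS)"
proof -
  let ?w = "dwin (dominating n es) {0..<n} {}"
  have w: "?w p \<longleftrightarrow> dwin (covers (adj es) A) A {} p" for p
    using assms(1) unfolding residual_def dominating_eq_covers by blast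
  have D: "?w p \<Longrightarrow> dom_wins n es {} {} p" for p using dwin_imp_dom_wins[of n es "{}" "{}" p] by simp
  have S: "\<not> ?w p \<Longrightarrow> stal_wins n es {} {} p" for p using not_dwin_imp_stal_wins[of n es "{}" "{}" p] by simp
  show ?thesis
  proof (cases "A = {}")
    case True
    then have "?w p" for p unfolding w by (simp add: covers_def)
    then show ?thesis using True D unfolding has_outcome_def by simp
  next
    case False
    have "treelike A" using assms(1) unfolding residual_def by blast
    then have "\<not> ?w False" "?w True \<longleftrightarrow> (\<exists>v<n. card A \<le> deg es A v + 1)"
      unfolding w using residual_outcome[OF _ False assms(2)] by blast+
    then show ?thesis using False D S unfolding has_outcome_def by auto
  qed
qed

end

section \<open>Structured programs on the RAM\<close>

type_synonym mem = "nat \<Rightarrow> nat"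

datatype com = Blk "instr list" | Seq com com (infixr ";;" 60) | Ifz nat com com | While nat com

fun upd :: "instr \<Rightarrow> mem \<Rightarrow> mem" where
  "upd (Const r c) m = m(r := c)"
| "upd (Add r a b) m = m(r := m a + m b)"
| "upd (Sub r a b) m = m(r := m a - m b)"
| "upd (Load r a) m = m(r := m (m a))"
| "upd (Store a r) m = m(m a := m r)"
| "upd (Jz r l) m = m"
| "upd (Jmp l) m = m"

fun upds :: "instr list \<Rightarrow> mem \<Rightarrow> mem" where
  "upds [] m = m"
| "upds (i # is) m = upds is (upd i m)"

lemma upds_append: "upds (xs @ ys) m = upds ys (upds xs m)"
  by (induction xs arbitrary: m) auto

text \<open>\<open>upd\<close> ignores jumps while \<open>exec\<close> obeys them, so the two agree
  only on blocks without jumps.\<close>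

fun basic :: "instr \<Rightarrow> bool" where
  "basic (Jz r l) = False"
| "basic (Jmp l) = False"
| "basic _ = True"

fun wf_com :: "com \<Rightarrow> bool" where
  "wf_com (Blk is) = list_all basic is"
| "wf_com (c1 ;; c2) = (wf_com c1 \<and> wf_com c2)"
| "wf_com (Ifz r c1 c2) = (wf_com c1 \<and> wf_com c2)"
| "wf_com (While r c) = wf_com c"

section \<open>Compilation and exact step counts\<close>

fun csize :: "com \<Rightarrow> nat" where
  "csize (Blk is) = length is"
| "csize (c1 ;; c2) = csize c1 + csize c2"
| "csize (Ifz r c1 c2) = csize c1 + csize c2 + 2"
| "csize (While r c) = csize c + 2"

text \<open>Jump targets are absolute, hence the start address \<open>p\<close>. The nonzero branch
  comes first because \<open>Jz\<close> falls through to it.\<close>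

fun compile :: "nat \<Rightarrow> com \<Rightarrow> instr list" where
  "compile p (Blk is) = is"
| "compile p (c1 ;; c2) = compile p c1 @ compile (p + csize c1) c2"
| "compile p (Ifz r c1 c2) =
     Jz r (p + csize c2 + 2) # compile (p + 1) c2
     @ Jmp (p + csize c2 + 2 + csize c1) # compile (p + csize c2 + 2) c1"
| "compile p (While r c) = Jz r (p + csize c + 2) # compile (p + 1) c @ [Jmp p]"

lemma length_compile [simp]: "length (compile p c) = csize c"
  by (induction p c rule: compile.induct) auto

text \<open>The step counts mirror the compiled code: one for \<open>Jz\<close>, and one for the
  \<open>Jmp\<close> that closes a nonzero branch or a loop body.\<close>

inductive runs :: "com \<Rightarrow> mem \<Rightarrow> nat \<Rightarrow> mem \<Rightarrow> bool" where
  Blk: "runs (Blk is) m (length is) (upds is m)"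
| Seq: "runs c1 m t1 m1 \<Longrightarrow> runs c2 m1 t2 m2 \<Longrightarrow> runs (c1 ;; c2) m (t1 + t2) m2"
| Ifz0: "m r = 0 \<Longrightarrow> runs c1 m t m' \<Longrightarrow> runs (Ifz r c1 c2) m (1 + t) m'"
| Ifz1: "m r \<noteq> 0 \<Longrightarrow> runs c2 m t m' \<Longrightarrow> runs (Ifz r c1 c2) m (1 + t + 1) m'"
| While0: "m r = 0 \<Longrightarrow> runs (While r c) m 1 m"
| While1: "m r \<noteq> 0 \<Longrightarrow> runs c m t1 m1 \<Longrightarrow> runs (While r c) m1 t2 m2 \<Longrightarrow>
    runs (While r c) m (1 + t1 + 1 + t2) m2"

lemma steps_trans:
  "(f ^^ a) x = y \<Longrightarrow> (f ^^ b) y = z \<Longrightarrow> (f ^^ (a + b)) x = z"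
  by (simp add: funpow_add add.commute[of a])

lemma exec_upds:
  assumes "list_all basic is" "P = pre @ is @ post"
  shows "(exec P ^^ length is) (length pre, m) = (length pre + length is, upds is m)"
  using assms
proof (induction "is" arbitrary: pre m)
  case (Cons i "is")
  have "exec P (length pre, m) = (length (pre @ [i]), upd i m)"
    using Cons.prems by (cases i) (auto simp: nth_append)
  moreover have "(exec P ^^ length is) (length (pre @ [i]), upd i m) =
      (length (pre @ [i]) + length is, upds is (upd i m))"
    by (rule Cons.IH) (use Cons.prems in auto)
  ultimately show ?case by (simp add: funpow_swap1)
qed simp

lemma exec_Jz: "P = pre @ Jz r l # post \<Longrightarrow>
    (exec P ^^ 1) (length pre, m) = (if m r = 0 then l else length pre + 1, m)"
  by (simp add: nth_append)

lemma exec_Jmp: "P = pre @ Jmp l # post \<Longrightarrow> (exec P ^^ 1) (length pre, m) = (l, m)"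
  by (simp add: nth_append)

lemma compile_correct:
  assumes "runs c m t m'" "wf_com c" "P = pre @ compile (length pre) c @ post"
  shows "(exec P ^^ t) (length pre, m) = (length pre + csize c, m')"
  using assms
proof (induction arbitrary: pre post rule: runs.induct)
  case (Blk "is" m)
  then show ?case using exec_upds by simp
next
  case (Seq c1 m t1 m1 c2 t2 m2)
  have "(exec P ^^ t1) (length pre, m) = (length pre + csize c1, m1)"
    by (rule Seq.IH(1)) (use Seq.prems in auto)
  moreover have "(exec P ^^ t2) (length (pre @ compile (length pre) c1), m1) =
      (length (pre @ compile (length pre) c1) + csize c2, m2)"
    by (rule Seq.IH(2)) (use Seq.prems in auto)
  ultimately show ?case by (simp add: steps_trans add.assoc)
next
  case (Ifz0 m r c1 t m' c2)
  let ?pre = "pre @ Jz r (length pre + csize c2 + 2) # compile (length pre + 1) c2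
     @ [Jmp (length pre + csize c2 + 2 + csize c1)]"
  have "(exec P ^^ 1) (length pre, m) = (length pre + csize c2 + 2, m)"
    using exec_Jz[of P pre r] Ifz0 by simp
  moreover have "(exec P ^^ t) (length ?pre, m) = (length ?pre + csize c1, m')"
    by (rule Ifz0.IH) (use Ifz0.prems in auto)
  ultimately show ?case by (intro steps_trans[where a = 1]) (auto simp: algebra_simps)
next
  case (Ifz1 m r c2 t m' c1)
  let ?pre = "pre @ [Jz r (length pre + csize c2 + 2)]"
  let ?l = "length pre + csize c2 + 2 + csize c1"
  have "(exec P ^^ 1) (length pre, m) = (length ?pre, m)"
    using exec_Jz[of P pre r] Ifz1 by simp
  moreover have "(exec P ^^ t) (length ?pre, m) = (length ?pre + csize c2, m')"
    by (rule Ifz1.IH) (use Ifz1.prems in auto)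
  moreover have "(exec P ^^ 1) (length (?pre @ compile (length pre + 1) c2), m') = (?l, m')"
    by (rule exec_Jmp) (use Ifz1.prems in auto)
  ultimately have "(exec P ^^ (1 + t + 1)) (length pre, m) = (?l, m')"
    by (intro steps_trans[where y = "(length ?pre + csize c2, m')"] steps_trans[where y = "(length ?pre, m)"])
      auto
  then show ?case by (simp add: algebra_simps)
next
  case (While0 m r c)
  then show ?case using exec_Jz[of P pre r "length pre + csize c + 2" "compile (length pre + 1) c @ Jmp (length pre) # post" m]
    by simp
next
  case (While1 m r c t1 m1 t2 m2)
  let ?pre = "pre @ [Jz r (length pre + csize c + 2)]"
  have "(exec P ^^ 1) (length pre, m) = (length ?pre, m)"
    using exec_Jz[of P pre r] While1 by simp
  moreover have "(exec P ^^ t1) (length ?pre, m) = (length ?pre + csize c, m1)"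
    by (rule While1.IH(1)) (use While1.prems in auto)
  moreover have "(exec P ^^ 1) (length (?pre @ compile (length pre + 1) c), m1) = (length pre, m1)"
    by (rule exec_Jmp) (use While1.prems in auto)
  moreover have "(exec P ^^ t2) (length pre, m1) = (length pre + csize (While r c), m2)"
    by (rule While1.IH(2)) (use While1.prems in auto)
  ultimately show ?case
    by (intro steps_trans[where y = "(length pre, m1)"]
        steps_trans[where y = "(length ?pre + csize c, m1)"] steps_trans[where y = "(length ?pre, m)"])
      auto
qed

section \<open>Total correctness with a time budget\<close>

definition wp :: "com \<Rightarrow> nat \<Rightarrow> (mem \<Rightarrow> bool) \<Rightarrow> mem \<Rightarrow> bool" where
  "wp c T Q m \<longleftrightarrow> (\<exists>t m'. t \<le> T \<and> runs c m t m' \<and> Q m')"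

lemma wp_mono: "wp c T Q m \<Longrightarrow> T \<le> T' \<Longrightarrow> (\<And>m'. Q m' \<Longrightarrow> Q' m') \<Longrightarrow> wp c T' Q' m"
  unfolding wp_def by (meson le_trans)

lemma wp_Blk: "Q (upds is m) \<Longrightarrow> wp (Blk is) (length is) Q m"
  unfolding wp_def using runs.Blk by blast

lemma wp_BlkI: "Q (upds is m) \<Longrightarrow> length is \<le> T \<Longrightarrow> wp (Blk is) T Q m"
  using wp_Blk wp_mono by blast

lemma wp_Seq:
  "wp c1 T1 R m \<Longrightarrow> (\<And>m1. R m1 \<Longrightarrow> wp c2 T2 Q m1) \<Longrightarrow> wp (c1 ;; c2) (T1 + T2) Q m"
  unfolding wp_def by (meson runs.Seq add_mono)

lemma wp_Seq_Blk: "wp c T Q (upds is m) \<Longrightarrow> wp (Blk is ;; c) (length is + T) Q m"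
  by (rule wp_Seq[where R = "\<lambda>m'. m' = upds is m"]) (auto intro: wp_Blk)

lemma wp_Ifz:
  assumes "m r = 0 \<Longrightarrow> wp c1 T Q m" "m r \<noteq> 0 \<Longrightarrow> wp c2 T Q m"
  shows "wp (Ifz r c1 c2) (T + 2) Q m"
proof (cases "m r = 0")
  case True
  then obtain t m' where "t \<le> T" "runs c1 m t m'" "Q m'" using assms unfolding wp_def by blast
  then show ?thesis using runs.Ifz0[of m r c1 t m' c2] True unfolding wp_def
    by (intro exI[of _ "1 + t"] exI[of _ m']) auto
next
  case False
  then obtain t m' where "t \<le> T" "runs c2 m t m'" "Q m'" using assms unfolding wp_def by blast
  then show ?thesis using runs.Ifz1[of m r c2 t m' c1] False unfolding wp_def
    by (intro exI[of _ "1 + t + 1"] exI[of _ m']) auto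
qed

text \<open>All loops count a register down to 0, so the invariant is indexed by the iterations
  still to come. Each costs a \<open>Jz\<close> and a \<open>Jmp\<close> besides the body; the final
  1 is the exit test.\<close>

lemma wp_While:
  assumes "\<And>k m. I (Suc k) m \<Longrightarrow> m r = Suc k \<Longrightarrow> wp c T (\<lambda>m'. I k m' \<and> m' r = k) m"
    and "I k m" "m r = k"
  shows "wp (While r c) (k * (T + 2) + 1) (I 0) m"
  using assms(2,3)
proof (induction k arbitrary: m)
  case 0
  then show ?case using runs.While0[of m r c] unfolding wp_def by auto
next
  case (Suc k)
  obtain t1 m1 where 1: "t1 \<le> T" "runs c m t1 m1" "I k m1" "m1 r = k"
    using assms(1)[OF Suc.prems] unfolding wp_def by blast
  obtain t2 m2 where 2: "t2 \<le> k * (T + 2) + 1" "runs (While r c) m1 t2 m2" "I 0 m2"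
    using Suc.IH[OF 1(3,4)] unfolding wp_def by blast
  have "m r \<noteq> 0" using Suc.prems by simp
  from runs.While1[of m r c t1 m1 t2 m2, OF this 1(2) 2(2)] show ?case
    unfolding wp_def using 1(1) 2(1,3) by (intro exI[of _ "1 + t1 + 1 + t2"] exI[of _ m2]) auto
qed

section \<open>The decision procedure\<close>

text \<open>Registers 2 to 7 hold the constants \<open>n\<close>, 1, the base of the edge array, the base of the array
  of alive flags, the number of edges, and 0. All scratch registers are below 50 and all arrays start
  above 50. \<open>fetch j a b x y\<close> loads the endpoints of edge \<open>j\<close> into \<open>a\<close> and \<open>b\<close> and sets \<open>x\<close> to 0 iff
  both are alive; \<open>deg_prog v\<close> adds the current degree of the vertex in register \<open>v\<close> to register 24.\<close>

definition fetch :: "nat \<Rightarrow> nat \<Rightarrow> nat \<Rightarrow> nat \<Rightarrow> nat \<Rightarrow> instr list" where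
  "fetch j a b x y =
     [Add x j j, Add x x 4, Load a x, Add x x 3, Load b x,
      Add x 5 a, Load x x, Add y 5 b, Load y y, Add x x y, Const y 2, Sub x y x]"

text \<open>Equality is tested by adding the two truncated differences, a sum that vanishes iff the
  registers agree.\<close>

definition deg_prog :: "nat \<Rightarrow> com" where
  "deg_prog v =
     Blk [Add 25 6 7] ;;
     While 25
       (Blk (Sub 25 25 3 # fetch 25 20 21 22 23 @
          [Sub 26 20 v, Sub 27 v 20, Add 26 26 27, Sub 27 21 v, Sub 28 v 21, Add 27 27 28]) ;;
        Ifz 22 (Ifz 26 (Blk [Add 24 24 3]) (Ifz 27 (Blk [Add 24 24 3]) (Blk []))) (Blk []))"

text \<open>Deletions take effect within the sweep, so later edges are judged by the current
  degrees. Register 34 becomes the truncated excess of the degree sum over 3.\<close>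

definition pass_prog :: com where
  "pass_prog =
     Blk [Add 13 6 7] ;;
     While 13
       (Blk (Sub 13 13 3 # fetch 13 30 31 32 33 @ [Const 24 0]) ;;
        Ifz 32
          (deg_prog 30 ;; deg_prog 31 ;; Blk [Const 34 3, Sub 34 24 34] ;;
           Ifz 34 (Blk [Add 34 5 30, Store 34 7, Add 34 5 31, Store 34 7]) (Blk []))
          (Blk []))"

definition prune_prog :: com where
  "prune_prog = Blk [Add 12 2 7] ;; While 12 (Blk [Sub 12 12 3] ;; pass_prog)"

definition answer_prog :: com where
  "answer_prog =
     Blk [Const 14 0, Add 15 2 7] ;;
     While 15 (Blk [Sub 15 15 3, Add 16 5 15, Load 16 16, Add 14 14 16]) ;;
     Blk [Const 0 0] ;;
     Ifz 14 (Blk [])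
       (Blk [Const 0 2, Add 15 2 7] ;;
        While 15
          (Blk [Sub 15 15 3, Const 24 0] ;; deg_prog 15 ;; Blk [Add 24 24 3, Sub 24 14 24] ;;
           Ifz 24 (Blk [Const 0 1]) (Blk [])))"

text \<open>Every fixed address may initially contain input. Only \<open>m 1\<close> is redundant for a tree, which is just
  enough to compute the free address \<open>50 + 2 * n\<close> there, store \<open>n\<close> at it, and save addresses 2 to 5
  behind it; a loop then copies the rest of the edge list.\<close>

definition save :: "nat \<Rightarrow> nat \<Rightarrow> instr list" where
  "save c r = [Const 0 c, Add 0 0 1, Store 0 r]"

definition relocate_prog :: com where
  "relocate_prog =
     Blk ([Const 1 50, Add 1 1 0, Add 1 1 0, Store 1 0] @ save 1 2 @ save 2 3 @ save 3 4 @ save 4 5 @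
          [Load 0 1, Add 0 0 0, Const 4 5, Sub 0 0 4]) ;;
     While 0 (Blk [Const 4 5, Add 2 0 4, Load 3 2, Const 4 4, Add 2 0 4, Add 2 2 1, Store 2 3,
                   Const 4 1, Sub 0 0 4])"

definition init_prog :: com where
  "init_prog =
     Blk [Load 2 1, Const 3 1, Add 4 1 3, Add 5 4 2, Add 5 5 2, Sub 6 2 3, Const 7 0, Add 10 2 7] ;;
     While 10 (Blk [Sub 10 10 3, Add 11 5 10, Store 11 3])"

definition tree_prog :: com where
  "tree_prog = relocate_prog ;; init_prog ;; prune_prog ;; answer_prog"

section \<open>Memory layout and frame rules\<close>

locale tree_input = forest +
  assumes edge_count: "length es + 1 = n"
begin

text \<open>Relocation sends address \<open>x\<close> to \<open>49 + 2 * n + x\<close>, so the edge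
  array moves from 2 to \<open>E\<close>. The offset clears both the scratch registers and the
  input, which ends below \<open>2 * n\<close>. \<open>F\<close> leaves \<open>2 * n\<close> cells
  for the edges.\<close>

definition E :: nat where "E = 51 + 2 * n"
definition F :: nat where "F = 51 + 4 * n"

definition edges_at :: "mem \<Rightarrow> bool" where
  "edges_at m \<longleftrightarrow> (\<forall>i<length es. m (i + i + E) = fst (es ! i) \<and> m (Suc (i + i + E)) = snd (es ! i))"

definition layout :: "mem \<Rightarrow> bool" where
  "layout m \<longleftrightarrow> m 2 = n \<and> m 3 = 1 \<and> m 4 = E \<and> m 5 = F \<and> m 6 = length es \<and> m 7 = 0 \<and> edges_at m"

definition holds :: "nat set \<Rightarrow> mem \<Rightarrow> bool" where
  "holds A m \<longleftrightarrow> layout m \<and> (\<forall>v<n. m (F + v) = of_bool (v \<in> A))"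

lemma bases: "51 \<le> E" "51 \<le> F" "i < length es \<Longrightarrow> i + i + E + 1 < F"
  using edge_count by (auto simp: E_def F_def)

text \<open>Writes from \<open>F\<close> upward are permitted here, as setting and clearing alive
  flags requires.\<close>

lemma layout_cong:
  assumes "layout m" "\<And>r. 2 \<le> r \<and> r \<le> 7 \<or> 50 \<le> r \<and> r < F \<Longrightarrow> m' r = m r"
  shows "layout m'"
proof -
  have "m' (i + i + E) = m (i + i + E)" "m' (Suc (i + i + E)) = m (Suc (i + i + E))" if "i < length es" for i
    by (rule assms(2); use bases(3)[OF that] bases(1) in linarith)+
  then show ?thesis using assms(1) assms(2)[of 2] assms(2)[of 3] assms(2)[of 4] assms(2)[of 5]
      assms(2)[of 6] assms(2)[of 7]
    unfolding layout_def edges_at_def by simp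
qed

text \<open>Frame rule: registers 8 to 49, as well as 0 and 1, are scratch.\<close>

lemma holds_cong:
  assumes "holds A m" "\<And>r. 2 \<le> r \<and> r \<le> 7 \<or> 50 \<le> r \<Longrightarrow> m' r = m r"
  shows "holds A m'"
proof -
  have "layout m'" using assms unfolding holds_def by (intro layout_cong[of m m']) auto
  moreover have "m' (F + v) = m (F + v)" for v by (rule assms(2)) (use bases(2) in auto)
  ultimately show ?thesis using assms(1) unfolding holds_def by simp
qed

text \<open>The difficulty is aliasing: array addresses are at least 51 and so never coincide with
  the scratch registers being overwritten.\<close>

lemma upds_fetch:
  assumes "holds A m" "m j = i" "i < length es" "distinct [j, a, b, x, y]" "{j, a, b, x, y} \<subseteq> {8..<50}"
  defines "m' \<equiv> upds (fetch j a b x y) m"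
  shows "m' a = fst (es ! i)" "m' b = snd (es ! i)" "m' x = 0 \<longleftrightarrow> i \<in> inner es A"
    "\<And>r. r \<notin> {a, b, x, y} \<Longrightarrow> m' r = m r"
proof -
  have d: "j \<noteq> a" "j \<noteq> b" "j \<noteq> x" "j \<noteq> y" "a \<noteq> b" "a \<noteq> x" "a \<noteq> y" "b \<noteq> x" "b \<noteq> y" "x \<noteq> y"
    using assms(4) by auto
  have regs: "m 3 = 1" "m 4 = E" "m 5 = F" using assms(1) unfolding holds_def layout_def by auto
  have ne: "k \<noteq> a" "k \<noteq> b" "k \<noteq> x" "k \<noteq> y" if "k \<le> 7 \<or> 50 \<le> k" for k
    using assms(5) that by auto
  have num: "3 \<noteq> a" "3 \<noteq> b" "3 \<noteq> x" "3 \<noteq> y" "4 \<noteq> a" "4 \<noteq> b" "4 \<noteq> x" "4 \<noteq> y" "5 \<noteq> a" "5 \<noteq> b" "5 \<noteq> x" "5 \<noteq> y"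
    by (rule ne; simp)+
  have edge: "m (i + i + E) = fst (es ! i)" "m (Suc (i + i + E)) = snd (es ! i)"
    using assms(1,3) unfolding holds_def layout_def edges_at_def by auto
  have alive: "m (F + fst (es ! i)) = of_bool (fst (es ! i) \<in> A)" "m (F + snd (es ! i)) = of_bool (snd (es ! i) \<in> A)"
    using assms(1) endpoints[OF assms(3)] unfolding holds_def by auto
  have far: "z \<noteq> a \<and> z \<noteq> b \<and> z \<noteq> x \<and> z \<noteq> y" if "E \<le> z \<or> F \<le> z" for z
    using ne[of z] that bases by linarith
  have far': "i + i + E \<noteq> x" "Suc (i + i + E) \<noteq> a" "Suc (i + i + E) \<noteq> x"
    "F + u \<noteq> a" "F + u \<noteq> b" "F + u \<noteq> x" "F + u \<noteq> y" for u
    using far[of "i + i + E"] far[of "Suc (i + i + E)"] far[of "F + u"] by auto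
  define f where "f = fst (es ! i)"
  define g where "g = snd (es ! i)"
  have m': "m' = m(x := 2 - (of_bool (f \<in> A) + of_bool (g \<in> A)), a := f, b := g, y := 2)"
    unfolding m'_def fetch_def upds.simps upd.simps
    by (simp add: d d[symmetric] num far' regs edge[folded f_def g_def] alive[folded f_def g_def] assms(2)
        fun_upd_twist)
  show "m' a = fst (es ! i)" "m' b = snd (es ! i)" "m' x = 0 \<longleftrightarrow> i \<in> inner es A"
    using d assms(3) by (auto simp: inner_def m' f_def g_def)
  show "m' r = m r" if "r \<notin> {a, b, x, y}" for r using that by (simp add: m')
qed

section \<open>Correctness and running time of the subprograms\<close>

lemma wp_deg_prog:
  assumes "holds A m" "v \<notin> {20..<30}"
  shows "wp (deg_prog v) (30 * n)
     (\<lambda>m'. m' 24 = m 24 + deg es A (m v) \<and> (\<forall>r. r \<notin> {20..<30} \<longrightarrow> m' r = m r)) m"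
proof -
  \<comment> \<open>The edge index runs downwards, so after reaching \<open>k\<close> exactly the
    incident edges of index at least \<open>k\<close> are counted.\<close>
  let ?I = "\<lambda>k m'. k \<le> length es \<and> m' 24 = m 24 + card {i \<in> inc es A (m v). k \<le> i} \<and> (\<forall>r. r \<notin> {20..<30} \<longrightarrow> m' r = m r)"
  have hold: "holds A m'" if "\<And>r. r \<notin> {20..<30} \<Longrightarrow> m' r = m r" for m'
    by (rule holds_cong[OF assms(1)]) (use that in auto)
  have regs: "m 3 = 1" "m 6 = length es" "m 7 = 0" using assms(1) unfolding holds_def layout_def by auto
  have "wp (deg_prog v) (length [Add 25 6 7] + (length es * (26 + 2) + 1)) (?I 0) m"
    unfolding deg_prog_def
  proof (rule wp_Seq, rule wp_Blk)
    show "?I (length es) (upds [Add 25 6 7] m) \<and> upds [Add 25 6 7] m 25 = length es"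
    proof -
      have "{i \<in> inc es A (m v). length es \<le> i} = {}" unfolding inc_def inner_def by auto
      then show ?thesis using regs by simp
    qed
    fix m1 assume m1: "?I (length es) m1 \<and> m1 25 = length es"
    show "wp (While 25
       (Blk (Sub 25 25 3 # fetch 25 20 21 22 23 @
          [Sub 26 20 v, Sub 27 v 20, Add 26 26 27, Sub 27 21 v, Sub 28 v 21, Add 27 27 28]) ;;
        Ifz 22 (Ifz 26 (Blk [Add 24 24 3]) (Ifz 27 (Blk [Add 24 24 3]) (Blk []))) (Blk [])))
       (length es * (26 + 2) + 1) (?I 0) m1"
    proof (rule wp_While)
      show "?I (length es) m1" "m1 25 = length es" using m1 by auto
      fix k m2 assume m2: "?I (Suc k) m2" "m2 25 = Suc k"
      let ?pre = "Sub 25 25 3 # fetch 25 20 21 22 23 @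
          [Sub 26 20 v, Sub 27 v 20, Add 26 26 27, Sub 27 21 v, Sub 28 v 21, Add 27 27 28]"
      let ?m3 = "m2(25 := k)"
      let ?m4 = "upds (fetch 25 20 21 22 23) ?m3"
      have h3: "holds A ?m3" by (rule hold) (use m2 in auto)
      have k: "k < length es" using m2 by simp
      note f = upds_fetch[OF h3 _ k, of 25 20 21 22 23]
      have v: "m2 v = m v" "?m4 v = m v" using m2 assms(2) f(4)[of v] by auto
      have m23: "m2 3 = 1" using m2 regs by simp
      let ?m5 = "upds ?pre m2"
      have m5: "?m5 = upds [Sub 26 20 v, Sub 27 v 20, Add 26 26 27, Sub 27 21 v, Sub 28 v 21, Add 27 27 28] ?m4"
        using m2 m23 by (simp add: upds_append)
      have v2: "v \<noteq> 26" "v \<noteq> 27" "v \<noteq> 28" using assms(2) by auto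
      have r: "?m5 26 = 0 \<longleftrightarrow> fst (es ! k) = m v" "?m5 27 = 0 \<longleftrightarrow> snd (es ! k) = m v"
        "?m5 22 = 0 \<longleftrightarrow> k \<in> inner es A" "?m5 24 = m2 24" "?m5 25 = k"
        "\<And>r. r \<notin> {20..<30} \<Longrightarrow> ?m5 r = m r"
        unfolding m5 using f v v2 m2 by auto
      have "length ?pre = 19" by (simp add: fetch_def)
      have split: "{i \<in> inc es A (m v). k \<le> i} =
          (if k \<in> inc es A (m v) then insert k {i \<in> inc es A (m v). Suc k \<le> i}
           else {i \<in> inc es A (m v). Suc k \<le> i})"
        by (auto simp: Suc_le_eq le_less)
      have card: "card {i \<in> inc es A (m v). k \<le> i} =
          card {i \<in> inc es A (m v). Suc k \<le> i} + of_bool (k \<in> inc es A (m v))"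
        unfolding split by auto
      have m53: "?m5 3 = 1" using r(6)[of 3] regs by simp
      have add: "?I k (upds [Add 24 24 3] ?m5) \<and> upds [Add 24 24 3] ?m5 25 = k" if "k \<in> inc es A (m v)"
        using that card r m2(1) m53 k by simp
      have skip: "?I k (upds [] ?m5) \<and> upds [] ?m5 25 = k" if "k \<notin> inc es A (m v)"
        using that card r m2(1) k by simp
      have "wp (Blk ?pre ;; Ifz 22 (Ifz 26 (Blk [Add 24 24 3]) (Ifz 27 (Blk [Add 24 24 3]) (Blk []))) (Blk []))
         (length ?pre + (((1 + 2) + 2) + 2)) (\<lambda>m'. ?I k m' \<and> m' 25 = k) m2"
      proof (rule wp_Seq[where R = "\<lambda>m'. m' = ?m5"])
        show "wp (Blk ?pre) (length ?pre) (\<lambda>m'. m' = ?m5) m2" by (rule wp_Blk) simp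
        fix m' assume m': "m' = ?m5"
        show "wp (Ifz 22 (Ifz 26 (Blk [Add 24 24 3]) (Ifz 27 (Blk [Add 24 24 3]) (Blk []))) (Blk []))
          (((1 + 2) + 2) + 2) (\<lambda>m'. ?I k m' \<and> m' 25 = k) m'"
          unfolding m'
        proof (intro wp_Ifz)
          assume "?m5 22 = 0" "?m5 26 = 0"
          then have "k \<in> inc es A (m v)" using r unfolding inc_def by auto
          from wp_Blk[of "\<lambda>m'. ?I k m' \<and> m' 25 = k", OF add[OF this]]
          show "wp (Blk [Add 24 24 3]) (1 + 2) (\<lambda>m'. ?I k m' \<and> m' 25 = k) ?m5"
            by (rule wp_mono) auto
        next
          assume "?m5 22 = 0" "?m5 26 \<noteq> 0" "?m5 27 = 0"
          then have "k \<in> inc es A (m v)" using r unfolding inc_def by auto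
          from wp_Blk[of "\<lambda>m'. ?I k m' \<and> m' 25 = k", OF add[OF this]]
          show "wp (Blk [Add 24 24 3]) 1 (\<lambda>m'. ?I k m' \<and> m' 25 = k) ?m5"
            by (rule wp_mono) auto
        next
          assume "?m5 22 = 0" "?m5 26 \<noteq> 0" "?m5 27 \<noteq> 0"
          then have "k \<notin> inc es A (m v)" using r unfolding inc_def by auto
          from wp_Blk[of "\<lambda>m'. ?I k m' \<and> m' 25 = k", OF skip[OF this]]
          show "wp (Blk []) 1 (\<lambda>m'. ?I k m' \<and> m' 25 = k) ?m5"
            by (rule wp_mono) auto
        next
          assume "?m5 22 \<noteq> 0"
          then have "k \<notin> inc es A (m v)" using r unfolding inc_def by auto
          from wp_Blk[of "\<lambda>m'. ?I k m' \<and> m' 25 = k", OF skip[OF this]]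
          show "wp (Blk []) (1 + 2 + 2) (\<lambda>m'. ?I k m' \<and> m' 25 = k) ?m5"
            by (rule wp_mono) auto
        qed
      qed
      then show "wp (Blk ?pre ;; Ifz 22 (Ifz 26 (Blk [Add 24 24 3]) (Ifz 27 (Blk [Add 24 24 3]) (Blk []))) (Blk []))
         26 (\<lambda>m'. ?I k m' \<and> m' 25 = k) m2"
        unfolding \<open>length ?pre = 19\<close> by simp
    qed
  qed
  then show ?thesis
    by (rule wp_mono) (use edge_count in \<open>auto simp: deg_def\<close>)
qed

lemma wp_pass_body:
  assumes "residual A" "holds A m" "k < length es" "m 13 = Suc k"
  shows "wp (Blk (Sub 13 13 3 # fetch 13 30 31 32 33 @ [Const 24 0]) ;;
        Ifz 32
          (deg_prog 30 ;; deg_prog 31 ;; Blk [Const 34 3, Sub 34 24 34] ;;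
           Ifz 34 (Blk [Add 34 5 30, Store 34 7, Add 34 5 31, Store 34 7]) (Blk []))
          (Blk [])) (60 * n + 24)
     (\<lambda>m'. m' 12 = m 12 \<and> m' 13 = k \<and>
        holds (if removable es A k then A - {fst (es ! k), snd (es ! k)} else A) m') m"
    (is "wp (Blk ?pre ;; Ifz 32 (_ ;; _ ;; _ ;; Ifz 34 (Blk ?rem) _) _) _ ?Q m")
proof -
  let ?a = "fst (es ! k)" and ?b = "snd (es ! k)"
  let ?m1 = "m(13 := k)"
  let ?m2 = "upds (fetch 13 30 31 32 33) ?m1"
  have ab: "?a < n" "?b < n" "?a \<noteq> ?b" using endpoints[OF assms(3)] by auto
  have "m 3 = 1" using assms(2) unfolding holds_def layout_def by auto
  then have m3: "upds ?pre m = ?m2(24 := 0)" (is "_ = ?m3")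
    using assms(4) by (simp add: upds_append)
  have h1: "holds A ?m1" by (rule holds_cong[OF assms(2)]) auto
  note f = upds_fetch[OF h1 _ assms(3), of 13 30 31 32 33]
  have r3: "?m3 30 = ?a" "?m3 31 = ?b" "?m3 32 = 0 \<longleftrightarrow> k \<in> inner es A" "?m3 24 = 0" "?m3 13 = k"
    "?m3 12 = m 12"
    using f by auto
  have h3: "holds A ?m3" by (rule holds_cong[OF h1]) (use f(4) in auto)
  have "wp (Ifz 32
          (deg_prog 30 ;; deg_prog 31 ;; Blk [Const 34 3, Sub 34 24 34] ;;
           Ifz 34 (Blk ?rem) (Blk [])) (Blk []))
          ((30 * n + (30 * n + (length [Const 34 3, Sub 34 24 34] + (4 + 2)))) + 2) ?Q ?m3"
  proof (rule wp_Ifz)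
    assume "?m3 32 \<noteq> 0"
    then have "\<not> removable es A k" using r3 unfolding removable_def by auto
    then show "wp (Blk []) (30 * n + (30 * n + (length [Const 34 3, Sub 34 24 34] + (4 + 2)))) ?Q ?m3"
      using r3 h3 by (intro wp_BlkI) auto
  next
    assume z: "?m3 32 = 0"
    show "wp (deg_prog 30 ;; deg_prog 31 ;; Blk [Const 34 3, Sub 34 24 34] ;;
           Ifz 34 (Blk ?rem) (Blk []))
          (30 * n + (30 * n + (length [Const 34 3, Sub 34 24 34] + (4 + 2)))) ?Q ?m3"
    proof (rule wp_Seq[OF wp_deg_prog[OF h3]])
      show "30 \<notin> {20..<30::nat}" by simp
      fix m4 assume m4: "m4 24 = ?m3 24 + deg es A (?m3 30) \<and> (\<forall>r. r \<notin> {20..<30} \<longrightarrow> m4 r = ?m3 r)"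
      have h4: "holds A m4" by (rule holds_cong[OF h3]) (use m4 in auto)
      show "wp (deg_prog 31 ;; Blk [Const 34 3, Sub 34 24 34] ;; Ifz 34 (Blk ?rem) (Blk []))
          (30 * n + (length [Const 34 3, Sub 34 24 34] + (4 + 2))) ?Q m4"
      proof (rule wp_Seq[OF wp_deg_prog[OF h4]])
        show "31 \<notin> {20..<30::nat}" by simp
        fix m5 assume m5: "m5 24 = m4 24 + deg es A (m4 31) \<and> (\<forall>r. r \<notin> {20..<30} \<longrightarrow> m5 r = m4 r)"
        have h5: "holds A m5" by (rule holds_cong[OF h4]) (use m5 in auto)
        have r5: "m5 r = ?m3 r" if "r \<notin> {20..<30}" for r using m4 m5 that by auto
        have d5: "m5 24 = deg es A ?a + deg es A ?b" using m4 m5 r3 by auto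
        let ?m6 = "m5(34 := m5 24 - 3)"
        have h6: "holds A ?m6" by (rule holds_cong[OF h5]) auto
        have r6: "?m6 30 = ?a" "?m6 31 = ?b" "?m6 13 = k" "?m6 12 = m 12" "?m6 5 = F" "?m6 7 = 0"
          using r5[of 30] r5[of 31] r5[of 13] r5[of 12] r3 h6 unfolding holds_def layout_def by auto
        have rem: "?m6 34 = 0 \<longleftrightarrow> removable es A k"
          using z r3 d5 unfolding removable_def by auto
        have "wp (Ifz 34 (Blk ?rem) (Blk [])) (4 + 2) ?Q ?m6"
        proof (rule wp_Ifz)
          assume "?m6 34 = 0"
          then have R: "removable es A k" using rem by simp
          let ?m7 = "?m6(34 := F + ?b, F + ?a := 0, F + ?b := 0)"
          have "F + ?a \<noteq> r" "F + ?b \<noteq> r" if "r < 50" for r using bases(2) that by auto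
          then have u: "upds ?rem ?m6 = ?m7" using r6 by (auto simp: fun_eq_iff)
          have "layout ?m7"
            by (rule layout_cong[of ?m6]) (use h6 bases(2) in \<open>auto simp: holds_def\<close>)
          moreover have "?m7 (F + v) = of_bool (v \<in> A - {?a, ?b})" if "v < n" for v
            using h6 bases(2) that unfolding holds_def by auto
          ultimately have "holds (A - {?a, ?b}) ?m7" unfolding holds_def by blast
          moreover have "?m7 12 = m 12" "?m7 13 = k" using r6 bases(2) by auto
          ultimately show "wp (Blk ?rem) 4 ?Q ?m6" using R unfolding u[symmetric] by (intro wp_BlkI) auto
        next
          assume "?m6 34 \<noteq> 0"
          then show "wp (Blk []) 4 ?Q ?m6" using rem r6 h6 by (intro wp_BlkI) auto
        qed
        moreover have "upds [Const 34 3, Sub 34 24 34] m5 = ?m6" by simp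
        ultimately show "wp (Blk [Const 34 3, Sub 34 24 34] ;; Ifz 34 (Blk ?rem) (Blk []))
          (length [Const 34 3, Sub 34 24 34] + (4 + 2)) ?Q m5"
          by (intro wp_Seq_Blk) simp
      qed
    qed
  qed
  then have "wp (Ifz 32
          (deg_prog 30 ;; deg_prog 31 ;; Blk [Const 34 3, Sub 34 24 34] ;;
           Ifz 34 (Blk ?rem) (Blk [])) (Blk []))
          ((30 * n + (30 * n + (length [Const 34 3, Sub 34 24 34] + (4 + 2)))) + 2) ?Q (upds ?pre m)"
    unfolding m3 .
  from wp_Seq_Blk[OF this] show ?thesis
    by (rule wp_mono) (auto simp: fetch_def)
qed

text \<open>The clause that \<open>A\<close> had a removable edge guarantees that a stable set stays
  unchanged in all later sweeps.\<close>

lemma wp_pass_prog: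
  assumes "residual A" "holds A m"
  shows "wp pass_prog (88 * n\<^sup>2)
     (\<lambda>m'. m' 12 = m 12 \<and> (\<exists>B. residual B \<and> holds B m' \<and>
        (B = A \<and> (\<forall>i. \<not> removable es A i) \<or> card B < card A \<and> (\<exists>i. removable es A i)))) m"
proof -
  \<comment> \<open>As long as \<open>B = A\<close>, every edge of index at least \<open>k\<close>
    has been tested against \<open>A\<close> itself.\<close>
  let ?I = "\<lambda>k m'. k \<le> length es \<and> m' 12 = m 12 \<and> (\<exists>B. residual B \<and> holds B m' \<and>
        (B = A \<and> (\<forall>i\<ge>k. \<not> removable es A i) \<or> card B < card A \<and> (\<exists>i. removable es A i)))"
  let ?m1 = "upds [Add 13 6 7] m"
  have "wp pass_prog (length [Add 13 6 7] + (length es * (60 * n + 24 + 2) + 1)) (?I 0) m"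
    unfolding pass_prog_def
  proof (rule wp_Seq_Blk, rule wp_While)
    have "holds A ?m1" by (rule holds_cong[OF assms(2)]) auto
    moreover have "\<forall>i\<ge>length es. \<not> removable es A i" unfolding removable_def inner_def by auto
    ultimately show "?I (length es) ?m1" using assms(1) by auto
    show "?m1 13 = length es" using assms(2) unfolding holds_def layout_def by auto
    fix k m2 assume m2: "?I (Suc k) m2" "m2 13 = Suc k"
    then obtain B where B: "residual B" "holds B m2"
      "B = A \<and> (\<forall>i\<ge>Suc k. \<not> removable es A i) \<or> card B < card A \<and> (\<exists>i. removable es A i)" by blast
    let ?C = "if removable es B k then B - {fst (es ! k), snd (es ! k)} else B"
    have C: "residual ?C" using residual_remove[OF B(1)] B(1) by auto
    have fin: "finite B" using B(1) unfolding residual_def treelike_def by (auto intro: finite_subset)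
    have less: "card ?C < card B" if "removable es B k"
      using that fin by (auto simp: removable_def inner_def intro!: psubset_card_mono)
    have prog: "?C = A \<and> (\<forall>i\<ge>k. \<not> removable es A i) \<or> card ?C < card A \<and> (\<exists>i. removable es A i)"
    proof (cases "removable es B k")
      case True
      then show ?thesis using less B(3) by auto
    next
      case False
      have "i = k \<or> Suc k \<le> i" if "k \<le> i" for i using that by auto
      then show ?thesis using False B(3) by auto
    qed
    have k: "k < length es" using m2 by simp
    show "wp (Blk (Sub 13 13 3 # fetch 13 30 31 32 33 @ [Const 24 0]) ;;
        Ifz 32
          (deg_prog 30 ;; deg_prog 31 ;; Blk [Const 34 3, Sub 34 24 34] ;;
           Ifz 34 (Blk [Add 34 5 30, Store 34 7, Add 34 5 31, Store 34 7]) (Blk []))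
          (Blk [])) (60 * n + 24) (\<lambda>m'. ?I k m' \<and> m' 13 = k) m2"
    proof (rule wp_mono[OF wp_pass_body[OF B(1,2) k m2(2)]])
      fix m' assume "m' 12 = m2 12 \<and> m' 13 = k \<and> holds ?C m'"
      then show "?I k m' \<and> m' 13 = k" using C prog m2 k by auto
    qed simp
  qed
  then show ?thesis
  proof (rule wp_mono)
    \<comment> \<open>Since \<open>n\<close> is at least 1, the additive 26 is absorbed into
      \<open>26 * n\<close>.\<close>
    have "length es * (60 * n + 24 + 2) \<le> n * (86 * n)"
      by (rule mult_mono) (use edge_count in auto)
    also have "\<dots> = 86 * n\<^sup>2" by (simp add: power2_eq_square)
    finally have "length es * (60 * n + 24 + 2) \<le> 86 * n\<^sup>2" .
    moreover have "1 \<le> n\<^sup>2" using edge_count by (simp add: Suc_le_eq)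
    moreover have "length [Add 13 6 7] = 1" by simp
    ultimately show "length [Add 13 6 7] + (length es * (60 * n + 24 + 2) + 1) \<le> 88 * n\<^sup>2"
      by presburger
  qed auto
qed

text \<open>With \<open>k\<close> sweeps to go, the set is stable or has at most \<open>k\<close>
  vertices; at \<open>k = 0\<close> the second case means that it is empty, which is stable
  too.\<close>

lemma wp_prune_prog:
  assumes "residual A" "holds A m" "card A \<le> n"
  shows "wp prune_prog (93 * n ^ 3)
     (\<lambda>m'. \<exists>B. residual B \<and> holds B m' \<and> (\<forall>i. \<not> removable es B i)) m"
proof -
  let ?I = "\<lambda>k m'. \<exists>B. residual B \<and> holds B m' \<and> ((\<forall>i. \<not> removable es B i) \<or> card B \<le> k)"
  let ?m1 = "upds [Add 12 2 7] m"
  have "wp prune_prog (length [Add 12 2 7] + (n * (length [Sub 12 12 3] + 88 * n\<^sup>2 + 2) + 1)) (?I 0) m"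
    unfolding prune_prog_def
  proof (rule wp_Seq_Blk, rule wp_While)
    have "holds A ?m1" by (rule holds_cong[OF assms(2)]) auto
    then show "?I n ?m1" using assms by blast
    show "?m1 12 = n" using assms(2) unfolding holds_def layout_def by auto
    fix k m2 assume m2: "?I (Suc k) m2" "m2 12 = Suc k"
    then obtain B where B: "residual B" "holds B m2" "(\<forall>i. \<not> removable es B i) \<or> card B \<le> Suc k" by blast
    have "m2 3 = 1" using B(2) unfolding holds_def layout_def by auto
    then have m3: "upds [Sub 12 12 3] m2 12 = k" using m2(2) by simp
    have h3: "holds B (upds [Sub 12 12 3] m2)" by (rule holds_cong[OF B(2)]) auto
    show "wp (Blk [Sub 12 12 3] ;; pass_prog) (length [Sub 12 12 3] + 88 * n\<^sup>2) (\<lambda>m'. ?I k m' \<and> m' 12 = k) m2"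
    proof (rule wp_Seq_Blk, rule wp_mono[OF wp_pass_prog[OF B(1) h3]])
      fix m' assume "m' 12 = upds [Sub 12 12 3] m2 12 \<and> (\<exists>C. residual C \<and> holds C m' \<and>
        (C = B \<and> (\<forall>i. \<not> removable es B i) \<or> card C < card B \<and> (\<exists>i. removable es B i)))"
      then show "?I k m' \<and> m' 12 = k" using m3 B(3) by fastforce
    qed simp
  qed
  then show ?thesis
  proof (rule wp_mono)
    fix m' assume "?I 0 m'"
    then obtain B where B: "residual B" "holds B m'" "(\<forall>i. \<not> removable es B i) \<or> card B \<le> 0" by blast
    have "finite B" using B(1) unfolding residual_def treelike_def by (auto intro: finite_subset)
    then have "\<forall>i. \<not> removable es B i" using B(3) by (auto simp: removable_def inner_def)
    then show "\<exists>B. residual B \<and> holds B m' \<and> (\<forall>i. \<not> removable es B i)" using B by blast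
  next
    have n1: "1 \<le> n" using edge_count by simp
    then have "1 \<le> n\<^sup>2" "1 \<le> n ^ 3" by (auto simp: Suc_le_eq)
    then have "n * (1 + 88 * n\<^sup>2 + 2) \<le> n * (91 * n\<^sup>2)"
      by (intro mult_left_mono) auto
    also have "\<dots> = 91 * n ^ 3" by (simp add: power2_eq_square power3_eq_cube)
    finally have "n * (1 + 88 * n\<^sup>2 + 2) \<le> 91 * n ^ 3" .
    moreover have "length [Add 12 2 7] = 1" "length [Sub 12 12 3] = 1" by simp_all
    ultimately show "length [Add 12 2 7] + (n * (length [Sub 12 12 3] + 88 * n\<^sup>2 + 2) + 1) \<le> 93 * n ^ 3"
      using \<open>1 \<le> n ^ 3\<close> by presburger
  qed
qed

lemma wp_answer_prog:
  assumes A: "A \<subseteq> {0..<n}" and h: "holds A m"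
  shows "wp answer_prog (60 * n\<^sup>2)
     (\<lambda>m'. m' 0 = (if A = {} then 0 else if \<exists>v<n. card A \<le> deg es A v + 1 then 1 else 2)) m"
proof -
  let ?I = "\<lambda>k m'. k \<le> n \<and> holds A m' \<and> m' 14 = card {v \<in> A. k \<le> v}"
  let ?J = "\<lambda>k m'. k \<le> n \<and> holds A m' \<and> m' 14 = card A \<and>
     m' 0 = (if \<exists>v<n. k \<le> v \<and> card A \<le> deg es A v + 1 then 1 else 2)"
  let ?Q = "\<lambda>m'. m' 0 = (if A = {} then 0 else if \<exists>v<n. card A \<le> deg es A v + 1 then 1 else 2)"
  let ?count = "[Sub 15 15 3, Add 16 5 15, Load 16 16, Add 14 14 16]"
  let ?test = "Blk [Sub 15 15 3, Const 24 0] ;; deg_prog 15 ;; Blk [Add 24 24 3, Sub 24 14 24] ;;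
           Ifz 24 (Blk [Const 0 1]) (Blk [])"
  have fin: "finite A" using A finite_subset by blast
  have regs: "m' 2 = n" "m' 3 = 1" "m' 5 = F" "m' 7 = 0" if "holds A m'" for m'
    using that unfolding holds_def layout_def by auto
  have count: "wp (While 15 (Blk ?count)) (n * (4 + 2) + 1) (?I 0) (upds [Const 14 0, Add 15 2 7] m)"
  proof (rule wp_While)
    have e: "{v \<in> A. n \<le> v} = {}" using A by auto
    have "holds A (upds [Const 14 0, Add 15 2 7] m)" by (rule holds_cong[OF h]) auto
    then show "?I n (upds [Const 14 0, Add 15 2 7] m)" unfolding e by simp
    show "upds [Const 14 0, Add 15 2 7] m 15 = n" using regs[OF h] by simp
    fix k m1 assume m1: "?I (Suc k) m1" "m1 15 = Suc k"
    have "m1 (F + k) = of_bool (k \<in> A)" using m1 unfolding holds_def by auto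
    then have u: "upds ?count m1 = m1(15 := k, 16 := of_bool (k \<in> A), 14 := m1 14 + of_bool (k \<in> A))"
      using regs[of m1] m1 bases(2) by (auto simp: fun_eq_iff)
    have "{v \<in> A. k \<le> v} = (if k \<in> A then insert k {v \<in> A. Suc k \<le> v} else {v \<in> A. Suc k \<le> v})"
      by (auto simp: Suc_le_eq le_less)
    then have "card {v \<in> A. k \<le> v} = card {v \<in> A. Suc k \<le> v} + of_bool (k \<in> A)"
      using fin by auto
    moreover have "holds A (upds ?count m1)"
      unfolding u by (rule holds_cong[of _ m1]) (use m1 in auto)
    ultimately have "?I k (upds ?count m1) \<and> upds ?count m1 15 = k" using m1 unfolding u by auto
    then show "wp (Blk ?count) 4 (\<lambda>m'. ?I k m' \<and> m' 15 = k) m1" by (intro wp_BlkI) auto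
  qed
  have test: "wp (While 15 ?test) (n * (30 * n + 7 + 2) + 1) (?J 0) m1"
    if m1: "?J n m1" "m1 15 = n" for m1
  proof (rule wp_While[where I = ?J])
    show "?J n m1" "m1 15 = n" by fact+
    fix k m2 assume m2: "?J (Suc k) m2" "m2 15 = Suc k"
    let ?m3 = "upds [Sub 15 15 3, Const 24 0] m2"
    have h3: "holds A ?m3" by (rule holds_cong[of _ m2]) (use m2 in auto)
    have r3: "?m3 15 = k" "?m3 24 = 0" "?m3 14 = card A" "?m3 0 = m2 0" using m2 regs[of m2] by auto
    have split: "(\<exists>v<n. k \<le> v \<and> P v) \<longleftrightarrow> P k \<or> (\<exists>v<n. Suc k \<le> v \<and> P v)" for P
      using m2 by (metis Suc_le_eq le_less order_refl)
    have "wp ?test (length [Sub 15 15 3, Const 24 0] + (30 * n + (length [Add 24 24 3, Sub 24 14 24] + (1 + 2))))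
       (\<lambda>m'. ?J k m' \<and> m' 15 = k) m2"
    proof (rule wp_Seq_Blk, rule wp_Seq[OF wp_deg_prog[OF h3]])
      show "15 \<notin> {20..<30::nat}" by simp
      fix m4 assume m4: "m4 24 = ?m3 24 + deg es A (?m3 15) \<and> (\<forall>r. r \<notin> {20..<30} \<longrightarrow> m4 r = ?m3 r)"
      have h4: "holds A m4" by (rule holds_cong[OF h3]) (use m4 in auto)
      let ?m5 = "upds [Add 24 24 3, Sub 24 14 24] m4"
      have h5: "holds A ?m5" by (rule holds_cong[OF h4]) auto
      have r4: "m4 24 = deg es A k" "m4 14 = card A" "m4 15 = k" "m4 0 = m2 0"
        using m4 r3 by (auto simp del: upds.simps)
      have r5: "?m5 24 = card A - (deg es A k + 1)" "?m5 14 = card A" "?m5 15 = k" "?m5 0 = m2 0"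
        using r4 regs[OF h4] by auto
      show "wp (Blk [Add 24 24 3, Sub 24 14 24] ;; Ifz 24 (Blk [Const 0 1]) (Blk []))
        (length [Add 24 24 3, Sub 24 14 24] + (1 + 2)) (\<lambda>m'. ?J k m' \<and> m' 15 = k) m4"
      proof (rule wp_Seq_Blk, rule wp_Ifz)
        assume "?m5 24 = 0"
        then have "card A \<le> deg es A k + 1" using r5 by (simp del: upds.simps)
        moreover have "holds A (?m5(0 := 1))" by (rule holds_cong[OF h5]) auto
        ultimately show "wp (Blk [Const 0 1]) 1 (\<lambda>m'. ?J k m' \<and> m' 15 = k) ?m5"
          using r5 m2 by (intro wp_BlkI) (auto simp: split)
      next
        assume "?m5 24 \<noteq> 0"
        then have "\<not> card A \<le> deg es A k + 1" using r5 by (simp del: upds.simps)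
        then show "wp (Blk []) 1 (\<lambda>m'. ?J k m' \<and> m' 15 = k) ?m5"
          using r5 m2 h5 by (intro wp_BlkI) (auto simp: split)
      qed
    qed
    then show "wp ?test (30 * n + 7) (\<lambda>m'. ?J k m' \<and> m' 15 = k) m2" by (rule wp_mono) auto
  qed
  have "wp answer_prog (length [Const 14 0, Add 15 2 7] + ((n * (4 + 2) + 1) + (length [Const 0 0] +
     ((length [Const 0 2, Add 15 2 7] + (n * (30 * n + 7 + 2) + 1)) + 2)))) ?Q m"
    unfolding answer_prog_def
  proof (rule wp_Seq_Blk, rule wp_Seq[OF count], rule wp_Seq_Blk, rule wp_Ifz)
    fix m1 assume m1: "?I 0 m1"
    let ?m2 = "upds [Const 0 0] m1"
    have h2: "holds A ?m2" by (rule holds_cong[of _ m1]) (use m1 in auto)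
    have c: "?m2 14 = card A" "?m2 0 = 0" using m1 by auto
    show "wp (Blk []) (length [Const 0 2, Add 15 2 7] + (n * (30 * n + 7 + 2) + 1)) ?Q ?m2" if "?m2 14 = 0"
    proof -
      have "A = {}" using that c fin by (simp del: upds.simps)
      then show ?thesis using c by (intro wp_BlkI) auto
    qed
    show "wp (Blk [Const 0 2, Add 15 2 7] ;; While 15 ?test)
        (length [Const 0 2, Add 15 2 7] + (n * (30 * n + 7 + 2) + 1)) ?Q ?m2" if "?m2 14 \<noteq> 0"
    proof (rule wp_Seq_Blk)
      have ne: "A \<noteq> {}" using that c by (auto simp del: upds.simps)
      let ?m3 = "upds [Const 0 2, Add 15 2 7] ?m2"
      have "holds A ?m3" by (rule holds_cong[OF h2]) auto
      moreover have "?m3 14 = card A" "?m3 0 = 2" "?m3 15 = n" using c regs[OF h2] by auto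
      ultimately have "?J n ?m3" "?m3 15 = n" by (auto simp del: upds.simps)
      from test[OF this] show "wp (While 15 ?test) (n * (30 * n + 7 + 2) + 1) ?Q ?m3"
        by (rule wp_mono) (use ne in auto)
    qed
  qed
  then show ?thesis
  proof (rule wp_mono)
    have "n \<le> n\<^sup>2" "1 \<le> n\<^sup>2" using edge_count by (auto simp: power2_eq_square Suc_le_eq)
    moreover have "n * (30 * n + 7 + 2) = 30 * n\<^sup>2 + 9 * n"
      by (simp add: power2_eq_square algebra_simps)
    ultimately show "length [Const 14 0, Add 15 2 7] + ((n * (4 + 2) + 1) + (length [Const 0 0] +
     ((length [Const 0 2, Add 15 2 7] + (n * (30 * n + 7 + 2) + 1)) + 2))) \<le> 60 * n\<^sup>2"
      by simp
  qed
qed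

lemma wp_relocate_prog:
  assumes "m 0 = n"
  shows "wp relocate_prog (50 * n)
     (\<lambda>m'. m' 1 = 50 + 2 * n \<and> m' (50 + 2 * n) = n \<and>
        (\<forall>x. 2 \<le> x \<and> x \<le> 2 * n \<longrightarrow> m' (49 + 2 * n + x) = m x)) m"
proof -
  let ?pre = "[Const 1 50, Add 1 1 0, Add 1 1 0, Store 1 0] @ save 1 2 @ save 2 3 @ save 3 4 @ save 4 5 @
          [Load 0 1, Add 0 0 0, Const 4 5, Sub 0 0 4]"
  let ?body = "[Const 4 5, Add 2 0 4, Load 3 2, Const 4 4, Add 2 0 4, Add 2 2 1, Store 2 3,
                   Const 4 1, Sub 0 0 4]"
  \<comment> \<open>With counter \<open>k\<close>, the addresses from \<open>k + 6\<close> on have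
    been copied. The start value \<open>2 * n - 5\<close> counts the addresses 6 to
    \<open>2 * n\<close>, and truncates to 0 if there are none. Addresses 2 to 5 are saved
    beforehand, as the loop uses 2, 3 and 4 as registers.\<close>
  let ?I = "\<lambda>k m'. k \<le> 2 * n - 5 \<and> m' 1 = 50 + 2 * n \<and> m' (50 + 2 * n) = n \<and>
     (\<forall>x. 6 \<le> x \<and> x \<le> 2 * n \<longrightarrow> m' x = m x) \<and>
     (\<forall>x. 2 \<le> x \<and> x < 6 \<or> k + 5 < x \<and> x \<le> 2 * n \<longrightarrow> m' (49 + 2 * n + x) = m x)"
  define b where "b = 50 + 2 * n"
  have far: "c + b \<noteq> r" "r \<noteq> c + b" "Suc b \<noteq> r" "r \<noteq> Suc b" "b \<noteq> r" "r \<noteq> b" if "r < 50" for c r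
    using that by (auto simp: b_def)
  have save: "upds (save c r) m' = m'(0 := c + b, c + b := m' r)" if "m' 1 = b" "r \<noteq> 0" for c r m'
    using that by (simp add: save_def)
  let ?m0 = "m(1 := b, b := n)"
  let ?m1 = "?m0(0 := 1 + b, 1 + b := m 2)"
  let ?m2 = "?m1(0 := 2 + b, 2 + b := m 3)"
  let ?m3 = "?m2(0 := 3 + b, 3 + b := m 4)"
  let ?m4 = "?m3(0 := 4 + b, 4 + b := m 5)"
  have m0: "upds [Const 1 50, Add 1 1 0, Add 1 1 0, Store 1 0] m = ?m0"
    using assms by (simp add: b_def add.commute)
  have m1: "upds (save 1 2) ?m0 = ?m1" by (subst save) (simp_all add: far)
  have m2: "upds (save 2 3) ?m1 = ?m2" by (subst save) (simp_all add: far)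
  have m3: "upds (save 3 4) ?m2 = ?m3" by (subst save) (simp_all add: far)
  have m4: "upds (save 4 5) ?m3 = ?m4" by (subst save) (simp_all add: far)
  have m5: "upds [Load 0 1, Add 0 0 0, Const 4 5, Sub 0 0 4] ?m4 = ?m4(0 := 2 * n, 4 := 5, 0 := 2 * n - 5)"
    by (simp add: far mult_2)
  have pre: "upds ?pre m = ?m4(0 := 2 * n, 4 := 5, 0 := 2 * n - 5)"
    unfolding upds_append m0 m1 m2 m3 m4 m5 ..
  have "wp relocate_prog (length ?pre + ((2 * n - 5) * (9 + 2) + 1)) (?I 0) m"
    unfolding relocate_prog_def
  proof (rule wp_Seq_Blk, rule wp_While)
    have "upds ?pre m (49 + 2 * n + x) = m x" if "2 \<le> x" "x < 6" for x
    proof -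
      have "x = 2 \<and> 49 + 2 * n + x = 1 + b \<or> x = 3 \<and> 49 + 2 * n + x = 2 + b \<or>
          x = 4 \<and> 49 + 2 * n + x = 3 + b \<or> x = 5 \<and> 49 + 2 * n + x = 4 + b"
        using that by (auto simp: b_def)
      then show ?thesis unfolding pre by (elim disjE conjE) (simp_all only:, simp_all add: far)
    qed
    moreover have "upds ?pre m 1 = b" "upds ?pre m b = n" unfolding pre by (simp_all add: far)
    moreover have "upds ?pre m x = m x" if "6 \<le> x" "x \<le> 2 * n" for x
      using that unfolding pre by (auto simp: b_def)
    ultimately show "?I (2 * n - 5) (upds ?pre m)" unfolding b_def by auto
    show "upds ?pre m 0 = 2 * n - 5" unfolding pre by simp
    fix k m1 assume m1: "?I (Suc k) m1" "m1 0 = Suc k"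
    let ?d = "55 + 2 * n + k"
    have src: "m1 (6 + k) = m (6 + k)" using m1 by auto
    have u: "upds ?body m1 = m1(2 := ?d, 3 := m (6 + k), ?d := m (6 + k), 4 := 1, 0 := k)"
      using m1 src by (auto simp: fun_eq_iff)
    have "?I k (upds ?body m1) \<and> upds ?body m1 0 = k"
    proof (intro conjI allI impI)
      fix x assume x: "2 \<le> x \<and> x < 6 \<or> k + 5 < x \<and> x \<le> 2 * n"
      show "upds ?body m1 (49 + 2 * n + x) = m x"
      proof (cases "x = 6 + k")
        case True
        then show ?thesis unfolding u by simp
      next
        case False
        then have "m1 (49 + 2 * n + x) = m x" using m1 x by auto
        then show ?thesis using False unfolding u by auto
      qed
    qed (use m1 in \<open>auto simp: u\<close>)
    then show "wp (Blk ?body) 9 (\<lambda>m'. ?I k m' \<and> m' 0 = k) m1" by (rule wp_BlkI) simp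
  qed
  then show ?thesis
    by (rule wp_mono) (use edge_count in \<open>auto simp: save_def\<close>)
qed

lemma wp_init_prog:
  assumes "m 1 = 50 + 2 * n" "m (50 + 2 * n) = n"
    and "\<And>x. 2 \<le> x \<Longrightarrow> x \<le> 2 * n \<Longrightarrow> m (49 + 2 * n + x) = init_mem n es x"
  shows "wp init_prog (20 * n) (holds {0..<n}) m"
proof -
  let ?pre = "[Load 2 1, Const 3 1, Add 4 1 3, Add 5 4 2, Add 5 5 2, Sub 6 2 3, Const 7 0, Add 10 2 7]"
  let ?body = "[Sub 10 10 3, Add 11 5 10, Store 11 3]"
  let ?I = "\<lambda>k m'. k \<le> n \<and> layout m' \<and> (\<forall>v<n. k \<le> v \<longrightarrow> m' (F + v) = 1)"
  have pre: "upds ?pre m = m(2 := n, 3 := 1, 4 := E, 5 := F, 6 := length es, 7 := 0, 10 := n)"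
    using assms edge_count by (auto simp: fun_eq_iff E_def F_def)
  have edges: "m (i + i + E) = fst (es ! i)" "m (Suc (i + i + E)) = snd (es ! i)" if "i < length es" for i
  proof -
    have "i + i + E = 49 + 2 * n + (2 + 2 * i)" "Suc (i + i + E) = 49 + 2 * n + (3 + 2 * i)"
      by (auto simp: E_def)
    moreover have "m (49 + 2 * n + (2 + 2 * i)) = fst (es ! i)" "m (49 + 2 * n + (3 + 2 * i)) = snd (es ! i)"
      using assms(3)[of "2 + 2 * i"] assms(3)[of "3 + 2 * i"] that edge_count
      by (auto simp: init_mem_def)
    ultimately show "m (i + i + E) = fst (es ! i)" "m (Suc (i + i + E)) = snd (es ! i)" by (simp_all only:)
  qed
  have "wp init_prog (length ?pre + (n * (3 + 2) + 1)) (?I 0) m"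
    unfolding init_prog_def
  proof (rule wp_Seq_Blk, rule wp_While)
    have "layout (upds ?pre m)"
      using edges bases(1) unfolding pre layout_def edges_at_def by auto
    then show "?I n (upds ?pre m)" by (simp del: upds.simps)
    show "upds ?pre m 10 = n" unfolding pre by simp
    fix k m1 assume m1: "?I (Suc k) m1" "m1 10 = Suc k"
    have u: "upds ?body m1 = m1(10 := k, 11 := F + k, F + k := 1)"
      using m1 bases(2) unfolding layout_def by (auto simp: fun_eq_iff)
    have "layout (upds ?body m1)"
      unfolding u by (rule layout_cong[of m1]) (use m1 bases(2) in auto)
    moreover have "upds ?body m1 (F + v) = 1" if "v < n" "k \<le> v" for v
      using m1 that bases(2) unfolding u by auto
    moreover have "upds ?body m1 10 = k" using bases(2) unfolding u by auto
    ultimately have "?I k (upds ?body m1) \<and> upds ?body m1 10 = k" using m1 by (auto simp del: upds.simps)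
    then show "wp (Blk ?body) 3 (\<lambda>m'. ?I k m' \<and> m' 10 = k) m1" by (intro wp_BlkI) auto
  qed
  then show ?thesis
    by (rule wp_mono) (use edge_count in \<open>auto simp: holds_def\<close>)
qed

end

section \<open>The complete program and its time bound\<close>

lemma wp_tree_prog:
  assumes t: "is_tree n es"
  shows "wp tree_prog (223 * (n + 1) ^ 3) (\<lambda>m'. \<exists>r. has_outcome n es r \<and> m' 0 = outcome_code r) (init_mem n es)"
proof -
  interpret forest n es by (rule tree_forest[OF t])
  interpret tree_input n es
    by unfold_locales (use t in \<open>auto simp: is_tree_def\<close>)
  have full: "residual {0..<n}" using tree_treelike[OF t] unfolding residual_def by blast
  have "wp tree_prog (50 * n + (20 * n + (93 * n ^ 3 + 60 * n\<^sup>2)))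
     (\<lambda>m'. \<exists>r. has_outcome n es r \<and> m' 0 = outcome_code r) (init_mem n es)"
    unfolding tree_prog_def
  proof (rule wp_Seq[OF wp_relocate_prog])
    show "init_mem n es 0 = n" by (simp add: init_mem_def)
    fix m1 assume m1: "m1 1 = 50 + 2 * n \<and> m1 (50 + 2 * n) = n \<and>
        (\<forall>x. 2 \<le> x \<and> x \<le> 2 * n \<longrightarrow> m1 (49 + 2 * n + x) = init_mem n es x)"
    show "wp (init_prog ;; prune_prog ;; answer_prog) (20 * n + (93 * n ^ 3 + 60 * n\<^sup>2))
       (\<lambda>m'. \<exists>r. has_outcome n es r \<and> m' 0 = outcome_code r) m1"
    proof (rule wp_Seq[OF wp_init_prog])
      fix m2 assume m2: "holds {0..<n} m2"
      show "wp (prune_prog ;; answer_prog) (93 * n ^ 3 + 60 * n\<^sup>2)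
       (\<lambda>m'. \<exists>r. has_outcome n es r \<and> m' 0 = outcome_code r) m2"
      proof (rule wp_Seq[OF wp_prune_prog[OF full m2]])
        fix m3 assume "\<exists>B. residual B \<and> holds B m3 \<and> (\<forall>i. \<not> removable es B i)"
        then obtain B where B: "residual B" "holds B m3" "\<And>i. \<not> removable es B i" by blast
        have "B \<subseteq> {0..<n}" using B(1) unfolding residual_def treelike_def by blast
        from wp_answer_prog[OF this B(2)]
        show "wp answer_prog (60 * n\<^sup>2) (\<lambda>m'. \<exists>r. has_outcome n es r \<and> m' 0 = outcome_code r) m3"
        proof (rule wp_mono)
          fix m' :: mem
          assume "m' 0 = (if B = {} then 0 else if \<exists>v<n. card B \<le> deg es B v + 1 then 1 else 2)"
          then show "\<exists>r. has_outcome n es r \<and> m' 0 = outcome_code r"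
            using has_outcome_residual[OF B(1,3)]
            by (intro exI[of _ "if B = {} then OutD else if \<exists>v<n. card B \<le> deg es B v + 1 then OutN else OutS"])
              auto
        qed simp
      qed simp
    qed (use m1 in auto)
  qed
  then show ?thesis
  proof (rule wp_mono)
    \<comment> \<open>223 is \<open>50 + 20 + 93 + 60\<close>, every power of \<open>n\<close> being
      bounded by \<open>(n + 1) ^ 3\<close>.\<close>
    have "n ^ 1 \<le> (n + 1) ^ 1" "n\<^sup>2 \<le> (n + 1)\<^sup>2" "n ^ 3 \<le> (n + 1) ^ 3"
      by (rule power_mono; simp)+
    moreover have "(n + 1) ^ 1 \<le> (n + 1) ^ 3" "(n + 1)\<^sup>2 \<le> (n + 1) ^ 3"
      by (rule power_increasing; simp)+
    ultimately show "50 * n + (20 * n + (93 * n ^ 3 + 60 * n\<^sup>2)) \<le> 223 * (n + 1) ^ 3"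
      by (simp only: power_one_right)
  qed
qed

lemma wf_tree_prog: "wf_com tree_prog"
  by (simp add: tree_prog_def relocate_prog_def init_prog_def prune_prog_def answer_prog_def
      pass_prog_def deg_prog_def fetch_def save_def)

theorem theorem8:
  shows "\<exists>(P :: instr list) (c :: nat) (k :: nat). \<forall>n es. is_tree n es \<longrightarrow>
           (\<exists>t. t \<le> c * (n + 1) ^ k \<and> fst (run P t n es) \<ge> length P \<and>
                (\<exists>r. has_outcome n es r \<and> snd (run P t n es) 0 = outcome_code r))"
proof (rule exI[of _ "compile 0 tree_prog"], rule exI[of _ 223], rule exI[of _ 3], intro allI impI)
  fix n es assume "is_tree n es"
  from wp_tree_prog[OF this] obtain t m' where t: "t \<le> 223 * (n + 1) ^ 3"
    and runs: "runs tree_prog (init_mem n es) t m'"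
    and r: "\<exists>r. has_outcome n es r \<and> m' 0 = outcome_code r"
    unfolding wp_def by blast
  \<comment> \<open>The run ends with the program counter just past the last instruction, which is a
    halted configuration.\<close>
  have "run (compile 0 tree_prog) t n es = (csize tree_prog, m')"
    using compile_correct[OF runs wf_tree_prog, of "compile 0 tree_prog" "[]" "[]"]
    unfolding run_def by simp
  then show "\<exists>t. t \<le> 223 * (n + 1) ^ 3 \<and> fst (run (compile 0 tree_prog) t n es) \<ge> length (compile 0 tree_prog) \<and>
                (\<exists>r. has_outcome n es r \<and> snd (run (compile 0 tree_prog) t n es) 0 = outcome_code r)"
    using t r by (intro exI[of _ t]) simp
qed

end
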